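(* Let $X=(X_1,\dots,X_N)$ be the queue length process with strictly positive arrival rates $\lambda_1,\dots,\lambda_N$ and a bounded partially decreasing service allocation $\phi=(\phi_1,\dots,\phi_N)$. Assume that there exists an $n\in\{1,\dots,N\}$ such that $$\lambda_i < L^{i-1}_i(\lambda_1,\dots,\lambda_{i-1};\phi)\qquad\text{for all } i=1,\dots,n.$$ Then the processes $X_1,\dots,X_n$ are stable, regardless of the initial state of $X$.
   Context: $\mathbb{Z}_+=\{0,1,2,\dots\}$, $\mathbb{R}_+=[0,\infty)$, $e_i$ is the $i$-th unit vector, and $\le$ on $\mathbb{Z}_+^N$ is the coordinatewise order. Queue length process: given arrival rates $\lambda_i>0$ and a bounded function $\phi=(\phi_1,\dots,\phi_N):\mathbb{Z}_+^N\to\mathbb{R}_+^N$ (the service allocation), $X$ is the continuous-time Markov process on $\mathbb{Z}_+^N$ with transitions $x\mapsto x+e_i$ at rate $\lambda_i$ and $x\mapsto x-e_i$ at rate $\phi_i(x)1(x_i>0)$, $i=1,\dots,N$. $\phi$ is partially decreasing if for all $i$, $\phi_i(x)\ge\phi_i(y)$ for all $x\le y$ in $\mathbb{Z}_+^N$ such that $x_i=y_i$. Lower partial limits: for $0\le n\le N$ and $1\le i\le N$, $$\ell^n\phi_i(x_1,\dots,x_n)=\lim_{r\to\infty}\ \inf_{x_{n+1},\dots,x_N>r}\phi_i(x_1,\dots,x_N)$$ (so $\ell^0\phi_i$ is a constant and $\ell^N\phi_i=\phi_i$). For $n\ge1$, $Y^n$ is the continuous-time Markov process on $\mathbb{Z}_+^n$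 with transitions $x\mapsto x+e_i$ at rate $\lambda_i$ and $x\mapsto x-e_i$ at rate $\ell^n\phi_i(x)1(x_i>0)$, $i=1,\dots,n$. If $Y^n$ has a unique stationary distribution $\pi^n$, then $$L^n_i(\lambda_1,\dots,\lambda_n;\phi)=\sum_{x\in\mathbb{Z}_+^n}\ell^n\phi_i(x)\,\pi^n(x),$$ and otherwise $L^n_i(\lambda_1,\dots,\lambda_n;\phi)=0$. For $n=0$, $L^0_i=\ell^0\phi_i$. A stochastic process $U$ with values in a countable space $S$ is stable if for every $\epsilon>0$ there is a finite set $K\subset S$ such that $\Pr(U(t)\notin K)\le\epsilon$ for all $t\ge0$. *)

theory Defs
  imports "HOL-Probability.Probability"
begin

section \<open>Continuous-time Markov processes on a countable state space\<close>

text \<open>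
  The kernel \<open>P t x\<close> is the law at time \<open>t\<close> of the process started from \<open>x\<close>.  The number
  \<open>q x y\<close> is the rate of the transition from \<open>x\<close> to \<open>y\<close> for \<open>y \<noteq> x\<close>; diagonal values of \<open>q\<close>
  are irrelevant.  Requiring \<open>P t x\<close> to be a probability distribution excludes explosion, and
  convergence of the total exit rate excludes mass escaping instantaneously.  For bounded rates
  these conditions determine \<open>P\<close> on \<open>S\<close> and for \<open>t \<ge> 0\<close>.
\<close>

definition transition_function ::
    "'s set \<Rightarrow> ('s \<Rightarrow> 's \<Rightarrow> real) \<Rightarrow> (real \<Rightarrow> 's \<Rightarrow> 's pmf) \<Rightarrow> bool" where
  "transition_function S q P \<longleftrightarrow>
     (\<forall>t\<ge>0. \<forall>x\<in>S. set_pmf (P t x) \<subseteq> S) \<and>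
     (\<forall>x\<in>S. P 0 x = return_pmf x) \<and>
     (\<forall>s\<ge>0. \<forall>t\<ge>0. \<forall>x\<in>S. P (s + t) x = bind_pmf (P s x) (P t)) \<and>
     (\<forall>x\<in>S. \<forall>y\<in>S - {x}. ((\<lambda>h. pmf (P h x) y / h) \<longlongrightarrow> q x y) (at_right 0)) \<and>
     (\<forall>x\<in>S. ((\<lambda>h. (1 - pmf (P h x) x) / h) \<longlongrightarrow> (\<Sum>\<^sub>\<infinity>y\<in>S - {x}. q x y)) (at_right 0))"

text \<open>
  The Markov property is expressed by the finite-dimensional distributions.  The initial
  distribution is arbitrary, and no regularity of the sample paths is demanded.
\<close>

definition markov_process ::
    "'w measure \<Rightarrow> 's set \<Rightarrow> ('s \<Rightarrow> 's \<Rightarrow> real) \<Rightarrow> (real \<Rightarrow> 'w \<Rightarrow> 's) \<Rightarrow> bool" where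
  "markov_process M S q X \<longleftrightarrow>
     prob_space M \<and> (\<forall>t\<ge>0. X t \<in> measurable M (count_space S)) \<and>
     (\<exists>P. transition_function S q P \<and>
        (\<forall>(k::nat) (t::nat \<Rightarrow> real) (x::nat \<Rightarrow> 's).
           0 \<le> t 0 \<longrightarrow> (\<forall>j<k. t j \<le> t (Suc j)) \<longrightarrow> (\<forall>j\<le>k. x j \<in> S) \<longrightarrow>
           measure M {\<omega>\<in>space M. \<forall>j\<le>k. X (t j) \<omega> = x j} =
             measure M {\<omega>\<in>space M. X (t 0) \<omega> = x 0} *
             (\<Prod>j<k. pmf (P (t (Suc j) - t j) (x j)) (x (Suc j)))))"

definition stationary_distribution :: "'s set \<Rightarrow> ('s \<Rightarrow> 's \<Rightarrow> real) \<Rightarrow> 's pmf \<Rightarrow> bool" where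
  "stationary_distribution S q \<pi> \<longleftrightarrow>
     set_pmf \<pi> \<subseteq> S \<and>
     (\<exists>P. transition_function S q P \<and> (\<forall>t\<ge>0. bind_pmf \<pi> (P t) = \<pi>))"

definition stable_process :: "'w measure \<Rightarrow> 's set \<Rightarrow> (real \<Rightarrow> 'w \<Rightarrow> 's) \<Rightarrow> bool" where
  "stable_process M S U \<longleftrightarrow>
     (\<forall>\<epsilon>>0. \<exists>K\<subseteq>S. finite K \<and> (\<forall>t\<ge>0. measure M {\<omega>\<in>space M. U t \<omega> \<notin> K} \<le> \<epsilon>))"

section \<open>Queue length processes\<close>

text \<open>
  Vectors in \<open>\<int>\<^sub>+\<^sup>n\<close> are extensional functions on the index set \<open>{1..n}\<close>, so that \<open>n\<close> may
  range over the natural numbers; for \<open>n = 0\<close> there is exactly one such vector.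
\<close>

definition states :: "nat \<Rightarrow> (nat \<Rightarrow> nat) set" where
  "states n = ({1..n} \<rightarrow>\<^sub>E UNIV)"

definition queue_rates ::
    "nat \<Rightarrow> (nat \<Rightarrow> real) \<Rightarrow> (nat \<Rightarrow> (nat \<Rightarrow> nat) \<Rightarrow> real) \<Rightarrow> (nat \<Rightarrow> nat) \<Rightarrow> (nat \<Rightarrow> nat) \<Rightarrow> real"
where
  "queue_rates n lam f x y =
     (\<Sum>i\<in>{1..n}. (if y = x(i := x i + 1) then lam i else 0) +
                   (if x i > 0 \<and> y = x(i := x i - 1) then f i x else 0))"

definition partially_decreasing :: "nat \<Rightarrow> (nat \<Rightarrow> (nat \<Rightarrow> nat) \<Rightarrow> real) \<Rightarrow> bool" where
  "partially_decreasing N \<phi> \<longleftrightarrow>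
     (\<forall>i\<in>{1..N}. \<forall>x\<in>states N. \<forall>y\<in>states N.
        (\<forall>j\<in>{1..N}. x j \<le> y j) \<longrightarrow> x i = y i \<longrightarrow> \<phi> i x \<ge> \<phi> i y)"

definition lower_partial_limit ::
    "nat \<Rightarrow> (nat \<Rightarrow> (nat \<Rightarrow> nat) \<Rightarrow> real) \<Rightarrow> nat \<Rightarrow> nat \<Rightarrow> (nat \<Rightarrow> nat) \<Rightarrow> real" where
  "lower_partial_limit N \<phi> n i x =
     lim (\<lambda>r::nat. INF y\<in>{y\<in>states N. (\<forall>j\<in>{1..n}. y j = x j) \<and> (\<forall>j\<in>{n<..N}. y j > r)}. \<phi> i y)"

definition limiting_rates ::
    "nat \<Rightarrow> (nat \<Rightarrow> (nat \<Rightarrow> nat) \<Rightarrow> real) \<Rightarrow> nat \<Rightarrow> (nat \<Rightarrow> real) \<Rightarrow>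
      (nat \<Rightarrow> nat) \<Rightarrow> (nat \<Rightarrow> nat) \<Rightarrow> real" where
  "limiting_rates N \<phi> n lam = queue_rates n lam (lower_partial_limit N \<phi> n)"

text \<open>
  \<open>mean_service N \<phi> n i lam\<close> is \<open>L\<^sup>n\<^sub>i(\<lambda>\<^sub>1, \<dots>, \<lambda>\<^sub>n; \<phi>)\<close>.  In the case \<open>n = 0\<close> the lower partial
  limit does not depend on its last argument, for which the only vector in \<open>\<int>\<^sub>+\<^sup>0\<close> is taken.
\<close>

definition mean_service ::
    "nat \<Rightarrow> (nat \<Rightarrow> (nat \<Rightarrow> nat) \<Rightarrow> real) \<Rightarrow> nat \<Rightarrow> nat \<Rightarrow> (nat \<Rightarrow> real) \<Rightarrow> real" where
  "mean_service N \<phi> n i lam =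
     (if n = 0 then lower_partial_limit N \<phi> 0 i (\<lambda>_. undefined)
      else if \<exists>!\<pi>. stationary_distribution (states n) (limiting_rates N \<phi> n lam) \<pi> then
        (\<Sum>\<^sub>\<infinity>x\<in>states n. lower_partial_limit N \<phi> n i x *
           pmf (THE \<pi>. stationary_distribution (states n) (limiting_rates N \<phi> n lam) \<pi>) x)
      else 0)"

end

theory Submission imports Defs begin

text \<open>
  Fix a queue \<open>m + 1 \<le> n\<close>.  Bounded rates allow uniformisation: the transition function is a Poisson
  mixture of the powers of a one-step operator on functions.  By partial decrease this operator
  maps increasing functions to increasing functions, and queue \<open>m + 1\<close> is dominated by a queue \<open>W\<close>
  that is served, while longer than \<open>r\<close>, at the rate \<open>\<psi>(Y)\<close>, where \<open>Y\<close> is the limiting network on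
  the queues \<open>1, \<dots>, m\<close> and \<open>\<psi>\<close> is the infimum of the service rate over states exceeding \<open>r\<close> in all
  remaining coordinates; for large \<open>r\<close> its stationary mean still exceeds the arrival rate.

  Start \<open>Y\<close> in its stationary distribution \<open>\<pi>\<close> and \<open>W\<close> in \<open>r\<close>, the smallest value it can return to.
  Then the law of \<open>(Y, W)\<close> increases in time, so the measures \<open>P(Y \<in> \<cdot>, W > c)\<close> converge as time grows;
  letting \<open>c \<rightarrow> \<infinity>\<close> they yield a measure \<open>\<nu> \<le> \<pi>\<close> describing \<open>Y\<close> when \<open>W\<close> escapes to infinity.  It is
  invariant for \<open>Y\<close>, hence \<open>\<nu> = p \<pi>\<close> by uniqueness of \<open>\<pi>\<close>.  The drift of \<open>(W - c)\<^sup>+\<close> cannot be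
  negative in the limit, i.e. \<open>p (\<lambda> - \<pi>(\<psi>)) \<ge> 0\<close>, so \<open>p = 0\<close> and \<open>W\<close> is tight.  Other initial
  states of \<open>Y\<close> are covered because every up-set has positive \<open>\<pi>\<close>-measure.
\<close>

section \<open>The uniformised chain as an operator on functions\<close>

text \<open>Departures carry no guard \<open>x i > 0\<close>: truncated subtraction leaves an empty
  queue unchanged, so its term vanishes. Functions live on all of
  \<open>nat \<Rightarrow> nat\<close>, so that chains with different index sets act on the same
  functions.\<close>

definition generator ::
    "nat set \<Rightarrow> (nat \<Rightarrow> real) \<Rightarrow> (nat \<Rightarrow> (nat \<Rightarrow> nat) \<Rightarrow> real) \<Rightarrow>
      ((nat \<Rightarrow> nat) \<Rightarrow> real) \<Rightarrow> (nat \<Rightarrow> nat) \<Rightarrow> real" where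
  "generator A lam g f x =
     (\<Sum>i\<in>A. lam i * (f (x(i := x i + 1)) - f x) + g i x * (f (x(i := x i - 1)) - f x))"

text \<open>The transition operator \<open>I + G / L\<close> of the chain uniformised at rate
  \<open>L\<close>.\<close>

definition step ::
    "nat set \<Rightarrow> (nat \<Rightarrow> real) \<Rightarrow> (nat \<Rightarrow> (nat \<Rightarrow> nat) \<Rightarrow> real) \<Rightarrow> real \<Rightarrow>
      ((nat \<Rightarrow> nat) \<Rightarrow> real) \<Rightarrow> (nat \<Rightarrow> nat) \<Rightarrow> real" where
  "step A lam g L f x = f x + generator A lam g f x / L"

text \<open>In particular, a function that is \<open>mono_coords A\<close> depends on the coordinates in \<open>A\<close> only.\<close>

definition mono_coords :: "nat set \<Rightarrow> ((nat \<Rightarrow> nat) \<Rightarrow> real) \<Rightarrow> bool" where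
  "mono_coords A f \<longleftrightarrow> (\<forall>x y. (\<forall>i\<in>A. x i \<le> y i) \<longrightarrow> f x \<le> f y)"

lemma mono_coordsD: "mono_coords A f \<Longrightarrow> (\<And>i. i \<in> A \<Longrightarrow> x i \<le> y i) \<Longrightarrow> f x \<le> f y"
  by (auto simp: mono_coords_def)

lemma mono_coords_cong: "mono_coords A f \<Longrightarrow> (\<And>i. i \<in> A \<Longrightarrow> x i = y i) \<Longrightarrow> f x = f y"
  by (intro antisym mono_coordsD[of A f]) auto

text \<open>The counterpart of \<open>partially_decreasing\<close> for arbitrary functions as
  states; it also forces \<open>g i\<close> to depend on the coordinates in \<open>A\<close>
  only.\<close>

definition antitone_rates :: "nat set \<Rightarrow> (nat \<Rightarrow> (nat \<Rightarrow> nat) \<Rightarrow> real) \<Rightarrow> bool" where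
  "antitone_rates A g \<longleftrightarrow>
     (\<forall>i\<in>A. \<forall>x y. (\<forall>j\<in>A. x j \<le> y j) \<longrightarrow> x i = y i \<longrightarrow> g i y \<le> g i x)"

text \<open>\<open>B\<close> bounds every individual service rate, so each queue can be given
  potential services at the same rate \<open>B\<close>; \<open>L\<close> dominates the total rate of
  all arrivals and potential services.\<close>

locale queue =
  fixes A :: "nat set" and lam :: "nat \<Rightarrow> real" and g :: "nat \<Rightarrow> (nat \<Rightarrow> nat) \<Rightarrow> real"
    and L B :: real
  assumes fin: "finite A"
    and lam_nonneg: "i \<in> A \<Longrightarrow> 0 \<le> lam i"
    and g_nonneg: "i \<in> A \<Longrightarrow> 0 \<le> g i x"
    and g_le: "i \<in> A \<Longrightarrow> g i x \<le> B"
    and L_pos: "0 < L"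
    and L_ge: "(\<Sum>i\<in>A. lam i + B) \<le> L"
begin

abbreviation "G \<equiv> generator A lam g"
abbreviation "T \<equiv> step A lam g L"

text \<open>A potential service at rate \<open>B\<close> splits into a departure at rate
  \<open>g i x\<close> and a void event at rate \<open>B - g i x\<close>. This exhibits
  \<open>T f x\<close> as a combination of values of \<open>f\<close> with nonnegative weights, from
  which positivity and monotonicity are read off.\<close>

lemma T_eq:
  "T f x = (\<Sum>i\<in>A. lam i * f (x(i := x i + 1)) + g i x * f (x(i := x i - 1)) + (B - g i x) * f x) / L
     + (1 - (\<Sum>i\<in>A. lam i + B) / L) * f x"
proof -
  have "G f x = (\<Sum>i\<in>A. lam i * f (x(i := x i + 1)) + g i x * f (x(i := x i - 1)) + (B - g i x) * f x)
      - (\<Sum>i\<in>A. lam i + B) * f x"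
    unfolding generator_def sum_distrib_right sum_subtractf[symmetric]
    by (intro sum.cong) (auto simp: algebra_simps)
  then show ?thesis
    by (simp only: step_def diff_divide_distrib) (simp add: algebra_simps)
qed

lemma rate_slack: "0 \<le> 1 - (\<Sum>i\<in>A. lam i + B) / L"
  using L_ge L_pos by simp

lemma T_mono:
  assumes "\<And>y. f y \<le> h y"
  shows "T f x \<le> T h x"
  unfolding T_eq
  by (intro add_mono divide_right_mono sum_mono mult_left_mono assms rate_slack)
     (use lam_nonneg g_nonneg g_le L_pos in auto)

lemma T_ge_arrival:
  assumes f: "\<And>y. 0 \<le> f y" and i: "i \<in> A"
  shows "lam i / L * f (x(i := x i + 1)) \<le> T f x"
proof -
  have nonneg: "0 \<le> lam j * f (x(j := x j + 1)) + g j x * f (x(j := x j - 1)) + (B - g j x) * f x"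
    if "j \<in> A" for j
    using lam_nonneg[OF that] g_nonneg[OF that, of x] g_le[OF that, of x] f
    by (intro add_nonneg_nonneg mult_nonneg_nonneg) auto
  have "lam i * f (x(i := x i + 1)) \<le>
      lam i * f (x(i := x i + 1)) + g i x * f (x(i := x i - 1)) + (B - g i x) * f x"
    using g_nonneg[OF i, of x] g_le[OF i, of x] f by simp
  also have "\<dots> \<le> (\<Sum>j\<in>A. lam j * f (x(j := x j + 1)) + g j x * f (x(j := x j - 1)) + (B - g j x) * f x)"
    by (rule member_le_sum[OF i _ fin]) (use nonneg in auto)
  finally have "lam i * f (x(i := x i + 1)) / L \<le> (\<Sum>j\<in>A. lam j * f (x(j := x j + 1)) + g j x * f (x(j := x j - 1)) + (B - g j x) * f x) / L"
    using L_pos by (simp add: divide_right_mono)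
  moreover have "0 \<le> (1 - (\<Sum>i\<in>A. lam i + B) / L) * f x"
    by (intro mult_nonneg_nonneg rate_slack f)
  ultimately show ?thesis unfolding T_eq by simp
qed

lemma T_linear: "T (\<lambda>x. a * f x + b * h x) x = a * T f x + b * T h x"
proof -
  have "G (\<lambda>x. a * f x + b * h x) x = a * G f x + b * G h x"
    unfolding generator_def sum_distrib_left sum.distrib[symmetric]
    by (intro sum.cong) (auto simp: algebra_simps)
  then show ?thesis
    using L_pos by (simp add: step_def field_simps)
qed

lemma T_const [simp]: "T (\<lambda>_. c) x = c"
  by (simp add: step_def generator_def)

lemma Tk_mono: "(\<And>y. f y \<le> h y) \<Longrightarrow> (T ^^ k) f x \<le> (T ^^ k) h x"
  by (induction k arbitrary: x) (auto intro: T_mono)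

lemma Tk_linear: "(T ^^ k) (\<lambda>x. a * f x + b * h x) x = a * (T ^^ k) f x + b * (T ^^ k) h x"
proof (induction k arbitrary: x)
  case (Suc k)
  have "(T ^^ k) (\<lambda>x. a * f x + b * h x) = (\<lambda>x. a * (T ^^ k) f x + b * (T ^^ k) h x)"
    using Suc by auto
  then show ?case by (simp add: T_linear)
qed simp

lemma Tk_const [simp]: "(T ^^ k) (\<lambda>_. c) x = c"
proof (induction k arbitrary: x)
  case (Suc k)
  then have "(T ^^ k) (\<lambda>_. c) = (\<lambda>_. c)" by auto
  then show ?case by simp
qed simp

lemma Tk_bounded:
  assumes "\<And>y. \<bar>f y\<bar> \<le> C"
  shows "\<bar>(T ^^ k) f x\<bar> \<le> C"
proof -
  have "(T ^^ k) f x \<le> (T ^^ k) (\<lambda>_. C) x" "(T ^^ k) (\<lambda>_. - C) x \<le> (T ^^ k) f x"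
    by (intro Tk_mono; use assms in \<open>auto simp: abs_le_iff minus_le_iff\<close>)+
  then show ?thesis by (simp add: abs_le_iff)
qed

section \<open>Preservation of increasing functions and comparison of chains\<close>

text \<open>Arrivals and potential services of the two states are coupled. If
  \<open>x i = y i\<close>, the larger state departs at a rate that is no greater; if
  \<open>x i < y i\<close>, even a departure from \<open>y\<close> alone leaves
  \<open>y i - 1\<close> no smaller than \<open>x i\<close>. So the comparison holds term by term in
  \<open>T_eq\<close>.\<close>

lemma T_mono_coords:
  assumes f: "mono_coords A f"
    and g: "antitone_rates A g"
  shows "mono_coords A (T f)"
  unfolding mono_coords_def
proof (intro allI impI)
  fix x y assume xy: "\<forall>i\<in>A. x i \<le> (y i :: nat)"
  have *: "lam i * f (x(i := x i + 1)) + g i x * f (x(i := x i - 1)) + (B - g i x) * f x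
      \<le> lam i * f (y(i := y i + 1)) + g i y * f (y(i := y i - 1)) + (B - g i y) * f y"
    if i: "i \<in> A" for i
  proof -
    have 1: "lam i * f (x(i := x i + 1)) \<le> lam i * f (y(i := y i + 1))"
      by (intro mult_left_mono mono_coordsD[OF f]) (use xy i lam_nonneg in auto)
    have fxy: "f x \<le> f y" by (rule mono_coordsD[OF f]) (use xy in auto)
    have fx: "f (x(i := x i - 1)) \<le> f x" for x by (rule mono_coordsD[OF f]) auto
    have 2: "g i x * f (x(i := x i - 1)) + (B - g i x) * f x
        \<le> g i y * f (y(i := y i - 1)) + (B - g i y) * f y"
    proof (cases "x i = y i")
      case True
      have fd: "f (x(i := x i - 1)) \<le> f (y(i := y i - 1))"
        by (rule mono_coordsD[OF f]) (use xy in auto)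
      have "g i x * f (x(i := x i - 1)) + (B - g i x) * f x = B * f x - g i x * (f x - f (x(i := x i - 1)))"
        by (simp add: algebra_simps)
      also have "\<dots> \<le> B * f x - g i y * (f x - f (x(i := x i - 1)))"
        using g i True xy fx[of x] by (auto intro!: mult_right_mono simp: antitone_rates_def)
      also have "\<dots> = (B - g i y) * f x + g i y * f (x(i := x i - 1))"
        by (simp add: algebra_simps)
      also have "\<dots> \<le> (B - g i y) * f y + g i y * f (y(i := y i - 1))"
        using fd fxy g_le[OF i] g_nonneg[OF i] by (intro add_mono mult_left_mono) auto
      finally show ?thesis by (simp add: algebra_simps)
    next
      case False
      then have "x i \<le> y i - 1" using xy i by (metis Suc_leI diff_Suc_1 diff_le_mono le_neq_implies_less One_nat_def)
      then have fd: "f x \<le> f (y(i := y i - 1))"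
        by (intro mono_coordsD[OF f]) (use xy in auto)
      have "g i x * f (x(i := x i - 1)) + (B - g i x) * f x \<le> g i x * f x + (B - g i x) * f x"
        by (intro add_mono mult_left_mono) (use fx[of x] g_nonneg[OF i] g_le[OF i] in auto)
      also have "\<dots> = g i y * f x + (B - g i y) * f x" by (simp add: algebra_simps)
      also have "\<dots> \<le> g i y * f (y(i := y i - 1)) + (B - g i y) * f y"
        by (intro add_mono mult_left_mono) (use fd fxy g_nonneg[OF i] g_le[OF i] in auto)
      finally show ?thesis .
    qed
    from 1 2 show ?thesis by simp
  qed
  show "T f x \<le> T f y"
    unfolding T_eq
    by (intro add_mono divide_right_mono sum_mono mult_left_mono * rate_slack mono_coordsD[OF f])
       (use xy L_pos in auto)
qed

lemma Tk_mono_coords: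
  assumes "mono_coords A f"
    and "antitone_rates A g"
  shows "mono_coords A ((T ^^ k) f)"
  by (induction k) (auto intro: T_mono_coords assms)

text \<open>Faster service lowers an increasing function because each departure difference is
  nonpositive, and the coordinates in \<open>C - A\<close> contribute nothing since \<open>f\<close>
  ignores them.\<close>

lemma T_dominated:
  assumes f: "mono_coords A f" and AC: "A \<subseteq> C" "finite C" and g': "\<And>i. i \<in> A \<Longrightarrow> g i x \<le> g' i x"
  shows "step C lam g' L f x \<le> T f x"
proof -
  have "generator C lam g' f x = generator A lam g' f x"
    unfolding generator_def
  proof (intro sum.mono_neutral_right ballI)
    fix i assume "i \<in> C - A"
    then have "f (x(i := c)) = f x" for c
      by (intro mono_coords_cong[OF f]) auto
    then show "lam i * (f (x(i := x i + 1)) - f x) + g' i x * (f (x(i := x i - 1)) - f x) = 0" by simp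
  qed (use AC in auto)
  also have "\<dots> \<le> G f x"
    unfolding generator_def
    by (intro sum_mono add_mono order_refl mult_right_mono_neg g') (auto intro!: mono_coordsD[OF f])
  finally show ?thesis using L_pos by (simp add: step_def divide_right_mono)
qed

text \<open>The slower chain keeps \<open>(T ^^ k) f\<close> increasing, so the one-step comparison
  can be applied again at every step.\<close>

lemma Tk_dominated:
  assumes f: "mono_coords A f" and AC: "A \<subseteq> C" and g': "\<And>i x. i \<in> A \<Longrightarrow> g i x \<le> g' i x"
    and Q: "queue C lam g' L B"
    and g: "antitone_rates A g"
  shows "(step C lam g' L ^^ k) f x \<le> (T ^^ k) f x"
proof (induction k arbitrary: x)
  case (Suc k)
  interpret Q: queue C lam g' L B by (rule Q)
  have "Q.T ((Q.T ^^ k) f) x \<le> Q.T ((T ^^ k) f) x" by (rule Q.T_mono) (rule Suc)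
  also have "\<dots> \<le> T ((T ^^ k) f) x"
    by (rule T_dominated[OF Tk_mono_coords[OF f g] AC Q.fin]) (rule g')
  finally show ?case by simp
qed simp

end

section \<open>Transition functions with bounded rates\<close>

text \<open>Only a right-hand derivative is given, so the mean value theorem is replaced by a
  last-exit argument: after tilting by a small slope, the function would still be decreasing to the
  right of the last time at which it is nonpositive.\<close>

lemma right_derivative_nonpos:
  fixes u D :: "real \<Rightarrow> real"
  assumes cont: "continuous_on {0..} u"
    and D: "\<And>t. 0 \<le> t \<Longrightarrow> ((\<lambda>h. (u (t + h) - u t) / h) \<longlongrightarrow> D t) (at_right 0)"
    and D_nonpos: "\<And>t. 0 \<le> t \<Longrightarrow> D t \<le> 0"
    and t: "0 \<le> t"
  shows "u t \<le> u 0"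
proof (rule field_le_epsilon)
  fix e' :: real assume "0 < e'"
  \<comment> \<open>The slope is small enough for the tilt up to time \<open>t\<close> to cost at
    most \<open>e'\<close>.\<close>
  define e where "e = e' / (t + 1)"
  have e: "0 < e" "e * t \<le> e'"
    using \<open>0 < e'\<close> t by (auto simp: e_def field_simps)
  define v where "v = (\<lambda>s. u s - u 0 - e * s)"
  have "v t \<le> 0"
  proof (rule ccontr)
    assume vt: "\<not> v t \<le> 0"
    have cont_v: "continuous_on {0..t} v"
      unfolding v_def by (intro continuous_intros continuous_on_subset[OF cont]) auto
    define S where "S = {0..t} \<inter> v -` {..0}"
    have "closed S"
      unfolding S_def by (rule continuous_closed_preimage[OF cont_v]) auto
    then have "compact S"
      unfolding S_def by (metis compact_Icc compact_Int_closed inf.left_idem)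
    moreover have "0 \<in> S" using t by (auto simp: S_def v_def)
    ultimately obtain s where s: "s \<in> S" "\<And>s'. s' \<in> S \<Longrightarrow> s' \<le> s"
      using compact_attains_sup[of S] by auto
    have s0: "0 \<le> s" "s < t" "v s \<le> 0"
      using s(1) vt by (auto simp: S_def order.strict_iff_order)
    have "((\<lambda>h. (u (s + h) - u s) / h - e) \<longlongrightarrow> D s - e) (at_right 0)"
      by (intro tendsto_intros D s0)
    moreover have "D s - e < 0" using D_nonpos[OF s0(1)] e by linarith
    ultimately have "\<forall>\<^sub>F h in at_right 0. (u (s + h) - u s) / h - e < 0"
      by (rule order_tendstoD)
    moreover have "\<forall>\<^sub>F h in at_right 0. h \<in> {0<..<t - s}"
      by (rule eventually_at_rightI[of 0 "t - s"]) (use s0 in auto)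
    ultimately have "\<forall>\<^sub>F h in at_right (0::real). False"
    proof eventually_elim
      case (elim h)
      then have "u (s + h) - u s < e * h" by (auto simp: field_simps)
      then have "v (s + h) < v s" by (simp add: v_def algebra_simps)
      then have "s + h \<in> S" using s0 elim by (auto simp: S_def)
      then show ?case using s(2)[of "s + h"] elim by auto
    qed
    then show False by simp
  qed
  then show "u t \<le> u 0 + e'" using e(2) by (simp add: v_def)
qed

lemma integrable_pmf_bounded:
  fixes f :: "'a \<Rightarrow> real"
  assumes "\<And>x. x \<in> set_pmf p \<Longrightarrow> \<bar>f x\<bar> \<le> C"
  shows "integrable (measure_pmf p) f"
  by (rule measure_pmf.integrable_const_bound[of _ C]) (use assms in \<open>auto simp: AE_measure_pmf_iff\<close>)

lemma abs_expectation_le: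
  fixes f :: "'a \<Rightarrow> real"
  assumes "\<And>x. x \<in> set_pmf p \<Longrightarrow> \<bar>f x\<bar> \<le> C"
  shows "\<bar>measure_pmf.expectation p f\<bar> \<le> C"
proof -
  have f: "integrable (measure_pmf p) f" by (rule integrable_pmf_bounded[OF assms])
  have "measure_pmf.expectation p f \<le> C"
    by (rule measure_pmf.integral_le_const[OF f]) (use assms in \<open>auto simp: AE_measure_pmf_iff abs_le_iff\<close>)
  moreover have "- C \<le> measure_pmf.expectation p f"
    by (rule measure_pmf.integral_ge_const[OF f]) (use assms in \<open>fastforce simp: AE_measure_pmf_iff abs_le_iff\<close>)
  ultimately show ?thesis by simp
qed

lemma expectation_bind_pmf:
  fixes f :: "'b \<Rightarrow> real"
  assumes "\<And>x. \<bar>f x\<bar> \<le> C"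
  shows "measure_pmf.expectation (bind_pmf p k) f =
    measure_pmf.expectation p (\<lambda>x. measure_pmf.expectation (k x) f)"
  unfolding measure_pmf_bind
  by (rule integral_bind[where K="count_space UNIV" and B=C and B'=1])
     (use assms in \<open>auto simp: measure_pmf.emeasure_space_1 measure_pmf.finite_measure_axioms
       space_subprob_algebra subprob_space_measure_pmf\<close>)

lemma expectation_compl_indicator:
  "measure_pmf.expectation p (\<lambda>y. 1 - indicator S y :: real) = 1 - measure (measure_pmf p) S"
  by (subst Bochner_Integration.integral_diff)
     (auto simp: measure_pmf.prob_space intro!: integrable_pmf_bounded[of _ _ 1])

lemma fun_upd_states: "x \<in> states n \<Longrightarrow> i \<in> {1..n} \<Longrightarrow> x(i := c) \<in> states n"
  by (auto simp: states_def PiE_iff extensional_def)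

text \<open>The exit rate from \<open>x\<close> converges to the sum of the rates to the neighbours
  of \<open>x\<close>, so all other states together are reached with probability \<open>o(h)\<close>
  and do not affect the derivative for bounded \<open>F\<close>.\<close>

lemma transition_function_generator:
  fixes F :: "(nat \<Rightarrow> nat) \<Rightarrow> real"
  assumes P: "transition_function (states n) (queue_rates n lam g) P"
    and x: "x \<in> states n" and F: "\<And>y. \<bar>F y\<bar> \<le> C"
  shows "((\<lambda>h. (measure_pmf.expectation (P h x) F - F x) / h) \<longlongrightarrow> generator {1..n} lam g F x) (at_right 0)"
proof -
  define q where "q = queue_rates n lam g x"
  \<comment> \<open>The state \<open>x\<close> is removed because the decrement of an empty queue
    returns \<open>x\<close> itself.\<close>
  define Nb where "Nb = (\<Union>i\<in>{1..n}. {x(i := x i + 1), x(i := x i - 1)}) - {x}"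
  have Nb: "finite Nb" "Nb \<subseteq> states n - {x}" "x \<notin> Nb"
    using x by (auto simp: Nb_def fun_upd_states simp del: fun_upd_apply)
  have q0: "q y = 0" if "y \<notin> Nb" "y \<noteq> x" for y
    using that by (auto simp: q_def queue_rates_def Nb_def intro!: sum.neutral)
  have lim_y: "((\<lambda>h. pmf (P h x) y / h) \<longlongrightarrow> q y) (at_right 0)" if "y \<in> Nb" for y
    using P x Nb that unfolding transition_function_def q_def by blast
  have "((\<lambda>h. (1 - pmf (P h x) x) / h) \<longlongrightarrow> (\<Sum>\<^sub>\<infinity>y\<in>states n - {x}. q y)) (at_right 0)"
    using P x unfolding transition_function_def q_def by blast
  also have "(\<Sum>\<^sub>\<infinity>y\<in>states n - {x}. q y) = (\<Sum>\<^sub>\<infinity>y\<in>Nb. q y)"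
    by (rule infsum_cong_neutral) (use Nb q0 in auto)
  finally have lim_x: "((\<lambda>h. (1 - pmf (P h x) x) / h) \<longlongrightarrow> (\<Sum>y\<in>Nb. q y)) (at_right 0)"
    using Nb by simp
  have G_eq: "(\<Sum>y\<in>Nb. q y * (F y - F x)) = generator {1..n} lam g F x"
  proof -
    have "(\<Sum>y\<in>Nb. q y * (F y - F x)) = (\<Sum>y\<in>insert x Nb. q y * (F y - F x))"
      using Nb by (simp add: sum.insert_if)
    also have "\<dots> = (\<Sum>i\<in>{1..n}. \<Sum>y\<in>insert x Nb.
       (if y = x(i := x i + 1) then lam i * (F y - F x) else 0) +
       (if y = x(i := x i - 1) then (if x i > 0 then g i x * (F y - F x) else 0) else 0))"
      unfolding q_def queue_rates_def sum_distrib_right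
      by (subst sum.swap, intro sum.cong refl) (auto simp: algebra_simps)
    also have "\<dots> = generator {1..n} lam g F x"
      unfolding generator_def
    proof (intro sum.cong refl)
      fix i assume i: "i \<in> {1..n}"
      have fi: "finite (insert x Nb)" "x(i := x i + 1) \<in> insert x Nb" "x(i := x i - 1) \<in> insert x Nb"
        using i Nb by (auto simp: Nb_def)
      show "(\<Sum>y\<in>insert x Nb. (if y = x(i := x i + 1) then lam i * (F y - F x) else 0) +
        (if y = x(i := x i - 1) then (if x i > 0 then g i x * (F y - F x) else 0) else 0)) =
        lam i * (F (x(i := x i + 1)) - F x) + g i x * (F (x(i := x i - 1)) - F x)"
        unfolding sum.distrib sum.delta[OF fi(1)] using fi by (auto simp: fun_upd_idem simp del: insert_iff)
    qed
    finally show ?thesis .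
  qed
  \<comment> \<open>\<open>R\<close> collects the states beyond the neighbours. Their mass is
    \<open>1 - pmf (P h x) x\<close> minus the mass of the neighbours, and after division by
    \<open>h\<close> these two terms have the same limit.\<close>
  define R where "R = (\<lambda>h. measure_pmf.expectation (P h x) (\<lambda>y. if y \<in> insert x Nb then 0 else F y - F x))"
  have split: "measure_pmf.expectation (P h x) F - F x = (\<Sum>y\<in>Nb. pmf (P h x) y * (F y - F x)) + R h" for h
  proof -
    have C: "\<bar>F y - F x\<bar> \<le> 2 * C" for y using F[of y] F[of x] by linarith
    then have C0: "0 \<le> 2 * C" by (metis abs_ge_zero order_trans)
    have "measure_pmf.expectation (P h x) F - F x = measure_pmf.expectation (P h x) (\<lambda>y. F y - F x)"
      by (subst Bochner_Integration.integral_diff) (auto intro: integrable_pmf_bounded F)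
    also have "\<dots> = measure_pmf.expectation (P h x) (\<lambda>y. (if y \<in> Nb then F y - F x else 0) +
        (if y \<in> insert x Nb then 0 else F y - F x))"
      by (intro Bochner_Integration.integral_cong refl) auto
    also have "\<dots> = measure_pmf.expectation (P h x) (\<lambda>y. if y \<in> Nb then F y - F x else 0) + R h"
      unfolding R_def
      by (subst Bochner_Integration.integral_add) (use C C0 in \<open>auto intro!: integrable_pmf_bounded[of _ _ "2 * C"]\<close>)
    also have "measure_pmf.expectation (P h x) (\<lambda>y. if y \<in> Nb then F y - F x else 0) =
        (\<Sum>y\<in>Nb. pmf (P h x) y * (F y - F x))"
      by (subst integral_measure_pmf[of Nb]) (use Nb in \<open>auto split: if_splits\<close>)
    finally show ?thesis .
  qed
  have R_le: "\<bar>R h\<bar> \<le> 2 * C * (1 - pmf (P h x) x - (\<Sum>y\<in>Nb. pmf (P h x) y))" for h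
  proof -
    have "\<bar>R h\<bar> \<le> measure_pmf.expectation (P h x) (\<lambda>y. 2 * C * (1 - indicator (insert x Nb) y))"
      unfolding R_def
    proof (rule order_trans[OF integral_abs_bound], rule integral_mono)
      have C: "\<bar>F y - F x\<bar> \<le> 2 * C" for y using F[of y] F[of x] by linarith
      then have C0: "0 \<le> 2 * C" by (metis abs_ge_zero order_trans)
      show "integrable (measure_pmf (P h x)) (\<lambda>y. \<bar>if y \<in> insert x Nb then 0 else F y - F x\<bar>)"
        "integrable (measure_pmf (P h x)) (\<lambda>y. 2 * C * (1 - indicator (insert x Nb) y))"
        by (rule integrable_pmf_bounded[of _ _ "2 * C"]; use C C0 in \<open>auto simp: indicator_def\<close>)+
      show "\<bar>if y \<in> insert x Nb then 0 else F y - F x\<bar> \<le> 2 * C * (1 - indicator (insert x Nb) y)" for y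
        using C C0 by (auto simp: indicator_def)
    qed
    also have "\<dots> = 2 * C * (1 - measure (measure_pmf (P h x)) (insert x Nb))"
      by (simp add: expectation_compl_indicator)
    also have "measure (measure_pmf (P h x)) (insert x Nb) = pmf (P h x) x + (\<Sum>y\<in>Nb. pmf (P h x) y)"
      using Nb by (simp add: measure_measure_pmf_finite)
    finally show ?thesis by (simp add: algebra_simps)
  qed
  have "((\<lambda>h. R h / h) \<longlongrightarrow> 0) (at_right 0)"
  proof (rule Lim_null_comparison)
    show "((\<lambda>h. 2 * C * ((1 - pmf (P h x) x) / h - (\<Sum>y\<in>Nb. pmf (P h x) y / h))) \<longlongrightarrow> 0) (at_right 0)"
      by (rule tendsto_eq_intros tendsto_sum lim_x lim_y refl | assumption)+ simp
    show "\<forall>\<^sub>F h in at_right 0. norm (R h / h)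
        \<le> 2 * C * ((1 - pmf (P h x) x) / h - (\<Sum>y\<in>Nb. pmf (P h x) y / h))"
    proof (rule eventually_at_rightI[of 0 1])
      fix h :: real assume "h \<in> {0<..<1}"
      then have "norm (R h / h) \<le> (2 * C * (1 - pmf (P h x) x - (\<Sum>y\<in>Nb. pmf (P h x) y))) / h"
        using R_le[of h] by (simp add: divide_right_mono)
      also have "\<dots> = 2 * C * ((1 - pmf (P h x) x) / h - (\<Sum>y\<in>Nb. pmf (P h x) y / h))"
        by (simp only: times_divide_eq_right[symmetric] diff_divide_distrib sum_divide_distrib)
      finally show "norm (R h / h) \<le> 2 * C * ((1 - pmf (P h x) x) / h - (\<Sum>y\<in>Nb. pmf (P h x) y / h))" .
    qed simp
  qed
  moreover have "((\<lambda>h. \<Sum>y\<in>Nb. pmf (P h x) y / h * (F y - F x)) \<longlongrightarrow> (\<Sum>y\<in>Nb. q y * (F y - F x))) (at_right 0)"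
    by (intro tendsto_sum tendsto_mult lim_y tendsto_const)
  ultimately have "((\<lambda>h. (\<Sum>y\<in>Nb. pmf (P h x) y / h * (F y - F x)) + R h / h) \<longlongrightarrow>
      (\<Sum>y\<in>Nb. q y * (F y - F x)) + 0) (at_right 0)"
    by (rule tendsto_add[rotated])
  then show ?thesis
    unfolding split G_eq by (simp add: add_divide_distrib sum_divide_distrib)
qed


section \<open>The semigroup of the uniformised chain and uniqueness of transition functions\<close>

context queue
begin

lemma G_eq: "G f x = L * (T f x - f x)"
  using L_pos by (simp add: step_def)

text \<open>The number of steps up to time \<open>t\<close> is Poisson with mean
  \<open>L * t\<close>, so this is \<open>exp (t G) f\<close>.\<close>

definition semigroup :: "((nat \<Rightarrow> nat) \<Rightarrow> real) \<Rightarrow> real \<Rightarrow> (nat \<Rightarrow> nat) \<Rightarrow> real" where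
  "semigroup f t x = exp (- (L * t)) * (\<Sum>k. (L * t) ^ k / fact k * (T ^^ k) f x)"

lemma summable_semigroup:
  assumes "\<And>y. \<bar>f y\<bar> \<le> C"
  shows "summable (\<lambda>k. s ^ k / fact k * (T ^^ k) f x)"
proof (rule summable_comparison_test')
  show "summable (\<lambda>k. C * (\<bar>s\<bar> ^ k / fact k))"
    using summable_exp[of "\<bar>s\<bar>"] by (intro summable_mult) (simp add: field_simps)
  show "norm (s ^ k / fact k * (T ^^ k) f x) \<le> C * (\<bar>s\<bar> ^ k / fact k)" for k
    using mult_right_mono[OF Tk_bounded[of f C k x, OF assms], of "\<bar>s\<bar> ^ k / fact k"]
    by (simp add: abs_mult power_abs mult.commute)
qed

lemma exp_sums: "(\<lambda>k. s ^ k / fact k) sums exp (s :: real)"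
  using exp_converges[of s] by (simp add: field_simps)

lemma semigroup_bounded:
  assumes f: "\<And>y. \<bar>f y\<bar> \<le> C" and t: "0 \<le> t"
  shows "\<bar>semigroup f t x\<bar> \<le> C"
proof -
  let ?s = "L * t"
  have s: "0 \<le> ?s" using t L_pos by simp
  have C: "(\<lambda>k. ?s ^ k / fact k * C) sums (exp ?s * C)"
    by (intro sums_mult2 exp_sums)
  have "\<bar>\<Sum>k. ?s ^ k / fact k * (T ^^ k) f x\<bar> \<le> exp ?s * C"
  proof -
    have le: "\<bar>?s ^ k / fact k * (T ^^ k) f x\<bar> \<le> ?s ^ k / fact k * C" for k
      using mult_left_mono[OF Tk_bounded[of f C k x, OF f], of "?s ^ k / fact k"] s
      by (simp add: abs_mult)
    have "norm (\<Sum>k. ?s ^ k / fact k * (T ^^ k) f x) \<le> (\<Sum>k. ?s ^ k / fact k * C)"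
      by (rule norm_suminf_le) (use C le in \<open>auto intro: sums_summable\<close>)
    then show ?thesis using C by (simp add: sums_iff)
  qed
  then have "exp (- ?s) * \<bar>\<Sum>k. ?s ^ k / fact k * (T ^^ k) f x\<bar> \<le> exp (- ?s) * (exp ?s * C)"
    by (intro mult_left_mono) auto
  also have "exp (- ?s) * (exp ?s * C) = C" by (simp add: exp_minus)
  finally show ?thesis by (simp only: semigroup_def abs_mult abs_exp_cancel)
qed

lemma semigroup_0 [simp]: "semigroup f 0 x = f x"
  using powser_zero[of "\<lambda>k. (T ^^ k) f x / fact k"] by (simp add: semigroup_def mult.commute)

text \<open>\<open>T\<close> combines finitely many values of its argument, so it passes through the
  pointwise convergent series.\<close>

lemma T_semigroup:
  assumes "\<And>y. \<bar>f y\<bar> \<le> C"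
  shows "T (semigroup f t) x = exp (- (L * t)) * (\<Sum>k. (L * t) ^ k / fact k * (T ^^ Suc k) f x)"
proof -
  define F where "F = (\<lambda>k x. (L * t) ^ k / fact k * (T ^^ k) f x)"
  have F: "(\<lambda>k. F k y) sums (\<Sum>k. F k y)" for y
    unfolding F_def by (intro summable_sums summable_semigroup[of f C]) (rule assms)
  have "(\<lambda>k. T (F k) x) sums T (\<lambda>y. \<Sum>k. F k y) x"
    unfolding step_def generator_def
    by (intro sums_add sums_divide sums_sum sums_mult sums_diff F)
  moreover have "T (F k) x = (L * t) ^ k / fact k * (T ^^ Suc k) f x" for k
    using T_linear[of "(L * t) ^ k / fact k" "(T ^^ k) f" 0 "\<lambda>_. 0" x] by (simp add: F_def)
  moreover have "T (semigroup f t) x = exp (- (L * t)) * T (\<lambda>y. \<Sum>k. F k y) x"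
    using T_linear[of "exp (- (L * t))" "\<lambda>y. \<Sum>k. F k y" 0 "\<lambda>_. 0" x]
    by (simp add: F_def semigroup_def[abs_def])
  ultimately show ?thesis by (simp add: sums_iff)
qed

text \<open>Differentiating the power series in \<open>L * t\<close> shifts its coefficients by one
  place, which amounts to one application of \<open>T\<close>; the result is the backward
  equation.\<close>

lemma semigroup_derivative:
  assumes f: "\<And>y. \<bar>f y\<bar> \<le> C"
  shows "((\<lambda>t. semigroup f t x) has_real_derivative G (semigroup f t) x) (at t)"
proof -
  define c where "c = (\<lambda>k. (T ^^ k) f x / fact k)"
  have sm: "summable (\<lambda>k. c k * s ^ k)" for s
    using summable_semigroup[of f C s x, OF f] by (simp add: c_def field_simps)
  have diffs: "diffs c k = (T ^^ Suc k) f x / fact k" for k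
    by (simp add: diffs_def c_def del: of_nat_Suc)
  have D: "((\<lambda>s. \<Sum>k. c k * s ^ k) has_real_derivative (\<Sum>k. diffs c k * s ^ k)) (at s)" for s
    by (rule termdiffs_strong_converges_everywhere[OF sm])
  have "((\<lambda>t. exp (- (L * t)) * (\<Sum>k. c k * (L * t) ^ k)) has_real_derivative
     exp (- (L * t)) * (L * (\<Sum>k. diffs c k * (L * t) ^ k)) - L * exp (- (L * t)) * (\<Sum>k. c k * (L * t) ^ k)) (at t)"
    by (rule derivative_eq_intros DERIV_chain2[OF D] refl)+ (simp add: algebra_simps)
  moreover have "(\<lambda>t. exp (- (L * t)) * (\<Sum>k. c k * (L * t) ^ k)) = (\<lambda>t. semigroup f t x)"
    by (simp add: semigroup_def c_def field_simps)
  moreover have "exp (- (L * t)) * (L * (\<Sum>k. diffs c k * (L * t) ^ k)) - L * exp (- (L * t)) * (\<Sum>k. c k * (L * t) ^ k)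
      = G (semigroup f t) x"
    unfolding G_eq T_semigroup[of f C, OF f] diffs
    by (simp add: semigroup_def c_def algebra_simps)
  ultimately show ?thesis by simp
qed

text \<open>The expectation and the semigroup solve the backward equation with the same initial
  value. Their difference \<open>w\<close> starts at \<open>0\<close>, and \<open>G w\<close> is at
  most \<open>2 * L\<close> times a bound on \<open>w\<close>, so repeated integration gives the
  bound \<open>2 * C * (2 * L * t) ^ j / fact j\<close> for every \<open>j\<close>.\<close>

lemma transition_function_unique:
  assumes A: "A = {1..n}"
    and P: "transition_function (states n) (queue_rates n lam g) P"
    and x: "x \<in> states n" and t: "0 \<le> t" and f: "\<And>y. \<bar>f y\<bar> \<le> C"
  shows "measure_pmf.expectation (P t x) f = semigroup f t x"
proof -
  define u where "u = (\<lambda>t x. measure_pmf.expectation (P t x) f)"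
  \<comment> \<open>\<open>w\<close> is set to \<open>0\<close> off \<open>states n\<close>, where
    nothing is known about \<open>P\<close>. Neighbours of states are states, so at a state
    \<open>G\<close> of \<open>w\<close> is still the difference of the two generators.\<close>
  define w where "w = (\<lambda>t x. if x \<in> states n then u t x - semigroup f t x else 0)"
  have C: "0 \<le> C" using f[of x] by linarith
  have u_le: "\<bar>u t x\<bar> \<le> C" for t x
    unfolding u_def by (rule abs_expectation_le) (rule f)
  have u_add: "u (h + t) x = measure_pmf.expectation (P h x) (u t)"
    if "0 \<le> h" "0 \<le> t" "x \<in> states n" for h t x
  proof -
    have "P (h + t) x = bind_pmf (P h x) (P t)"
      using P that unfolding transition_function_def by blast
    then show ?thesis unfolding u_def by (simp add: expectation_bind_pmf[of f C, OF f])
  qed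
  have u_deriv: "((\<lambda>h. (u (t + h) x - u t x) / h) \<longlongrightarrow> G (u t) x) (at_right 0)"
    if "0 \<le> t" "x \<in> states n" for t x
  proof (rule Lim_transform_eventually)
    show "((\<lambda>h. (measure_pmf.expectation (P h x) (u t) - u t x) / h) \<longlongrightarrow> G (u t) x) (at_right 0)"
      unfolding A by (rule transition_function_generator[OF P that(2) u_le])
    show "\<forall>\<^sub>F h in at_right 0. (measure_pmf.expectation (P h x) (u t) - u t x) / h = (u (t + h) x - u t x) / h"
      by (rule eventually_at_rightI[of 0 1]) (use that u_add in \<open>auto simp: add.commute\<close>)
  qed
  have u_diff: "\<bar>u (t + h) x - u t x\<bar> \<le> 2 * C * (1 - pmf (P h x) x)"
    if "0 \<le> t" "0 \<le> h" "x \<in> states n" for t h x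
  proof -
    have ge: "\<bar>u t y - u t x\<bar> \<le> 2 * C * (1 - indicator {x} y)" for y
      using u_le[of t x] u_le[of t y] by (auto simp: indicator_def)
    have le2: "\<bar>u t y - u t x\<bar> \<le> 2 * C" for y
      using u_le[of t x] u_le[of t y] by linarith
    have "u (t + h) x - u t x = measure_pmf.expectation (P h x) (\<lambda>y. u t y - u t x)"
      using that u_add[of h t x]
      by (subst Bochner_Integration.integral_diff) (auto intro: integrable_pmf_bounded u_le simp: add.commute)
    also have "\<bar>\<dots>\<bar> \<le> measure_pmf.expectation (P h x) (\<lambda>y. 2 * C * (1 - indicator {x} y))"
    proof (rule order_trans[OF integral_abs_bound], rule integral_mono)
      show "integrable (measure_pmf (P h x)) (\<lambda>y. \<bar>u t y - u t x\<bar>)"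
        "integrable (measure_pmf (P h x)) (\<lambda>y. 2 * C * (1 - indicator {x} y))"
        by (rule integrable_pmf_bounded[of _ _ "2 * C"]; use le2 C in \<open>auto simp: indicator_def\<close>)+
    qed (rule ge)
    also have "\<dots> = 2 * C * (1 - pmf (P h x) x)"
      by (simp add: expectation_compl_indicator pmf.rep_eq)
    finally show ?thesis .
  qed
  have stay: "((\<lambda>h. 2 * C * (1 - pmf (P h x) x)) \<longlongrightarrow> 0) (at_right 0)" if "x \<in> states n" for x
  proof -
    have "((\<lambda>h. (1 - pmf (P h x) x) / h) \<longlongrightarrow> (\<Sum>\<^sub>\<infinity>y\<in>states n - {x}. queue_rates n lam g x y)) (at_right 0)"
      using P that unfolding transition_function_def by blast
    then have "((\<lambda>h. 2 * C * ((1 - pmf (P h x) x) / h * h)) \<longlongrightarrow> 2 * C * ((\<Sum>\<^sub>\<infinity>y\<in>states n - {x}. queue_rates n lam g x y) * 0)) (at_right 0)"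
      by (intro tendsto_intros)
    moreover have "\<forall>\<^sub>F h in at_right 0. 2 * C * ((1 - pmf (P h x) x) / h * h) = 2 * C * (1 - pmf (P h x) x)"
      by (rule eventually_at_rightI[of 0 1]) auto
    ultimately show ?thesis
      by (simp only: mult_zero_right) (rule Lim_transform_eventually)
  qed
  \<comment> \<open>The bound \<open>u_diff\<close> does not involve the base time, so it yields
    continuity from the left as well as from the right.\<close>
  have u_cont: "continuous_on {0..} (\<lambda>t. u t x)" if x: "x \<in> states n" for x
    unfolding continuous_on_iff
  proof (intro ballI allI impI)
    fix s e :: real assume s: "s \<in> {0..}" and e: "0 < e"
    have "\<forall>\<^sub>F h in at_right 0. 2 * C * (1 - pmf (P h x) x) < e"
      by (rule order_tendstoD(2)[OF stay[OF x] e])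
    then obtain d where d: "0 < d" "\<And>h. 0 < h \<Longrightarrow> h < d \<Longrightarrow> 2 * C * (1 - pmf (P h x) x) < e"
      by (auto simp: eventually_at_right_field)
    have "dist (u t x) (u s x) < e" if "t \<in> {0..}" "dist t s < d" for t
    proof (cases "t = s")
      case False
      have le: "\<bar>u (a + (b - a)) x - u a x\<bar> < e" if "0 \<le> a" "a < b" "b < a + d" for a b
        using u_diff[of a "b - a" x] d(2)[of "b - a"] that x by simp
      show ?thesis
        using le[of t s] le[of s t] that s False
        by (auto simp: dist_real_def abs_if split: if_splits)
    qed (use e in auto)
    then show "\<exists>d>0. \<forall>t\<in>{0..}. dist t s < d \<longrightarrow> dist (u t x) (u s x) < e"
      using d(1) by blast
  qed
  have w_deriv: "((\<lambda>h. (w (t + h) x - w t x) / h) \<longlongrightarrow> G (w t) x) (at_right 0)"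
    if "0 \<le> t" "x \<in> states n" for t x
  proof -
    have "((\<lambda>h. (semigroup f (t + h) x - semigroup f t x) / h) \<longlongrightarrow> G (semigroup f t) x) (at_right 0)"
      using semigroup_derivative[where f=f and C=C and x=x and t=t, OF f] unfolding DERIV_def
      by (rule filterlim_mono) (auto simp: at_le)
    from tendsto_diff[OF u_deriv[OF that] this]
    have "((\<lambda>h. (w (t + h) x - w t x) / h) \<longlongrightarrow> G (u t) x - G (semigroup f t) x) (at_right 0)"
      using that by (simp add: w_def diff_divide_distrib[symmetric] algebra_simps)
    also have "G (u t) x - G (semigroup f t) x = G (w t) x"
      unfolding generator_def sum_subtractf[symmetric]
      using that A by (intro sum.cong refl) (auto simp: w_def fun_upd_states algebra_simps simp del: fun_upd_apply)
    finally show ?thesis .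
  qed
  have w_cont: "continuous_on {0..} (\<lambda>t. w t x)" for x
  proof (cases "x \<in> states n")
    case True
    have "continuous_on {0..} (\<lambda>t. semigroup f t x)"
      by (rule DERIV_continuous_on) (rule has_field_derivative_at_within[OF semigroup_derivative[of f C, OF f]])
    then show ?thesis using u_cont[OF True] True by (auto simp: w_def intro!: continuous_intros)
  qed (auto simp: w_def)
  have w0: "w 0 x = 0" for x
    using P by (auto simp: w_def u_def transition_function_def)
  have w_le: "\<bar>w t x\<bar> \<le> 2 * C * ((2 * L * t) ^ j / fact j)" if "0 \<le> t" for t x j
    using that
  proof (induction j arbitrary: t x)
    case 0
    then show ?case
      using u_le[of t x] semigroup_bounded[of f C t x, OF f 0] C by (auto simp: w_def)
  next
    case (Suc j)
    \<comment> \<open>\<open>b\<close> is the antiderivative, vanishing at \<open>0\<close>, of the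
      bound on \<open>G (w s) x\<close> that the previous stage supplies. Comparing it with
      \<open>w\<close> and with \<open>- w\<close> performs the integration.\<close>
    define b where "b = (\<lambda>s. 2 * C * ((2 * L * s) ^ Suc j / fact (Suc j)))"
    have b_deriv: "(b has_real_derivative 2 * L * (2 * C * ((2 * L * s) ^ j / fact j))) (at s)" for s
    proof -
      have "((\<lambda>s. (2 * L * s) ^ Suc j) has_real_derivative real (Suc j) * (2 * L) * (2 * L * s) ^ j) (at s)"
        by (rule derivative_eq_intros refl)+ simp
      from DERIV_cmult[OF this, of "2 * C / fact (Suc j)"] show ?thesis
        by (simp add: b_def mult_ac del: of_nat_Suc power_Suc)
    qed
    have b_right: "((\<lambda>h. (b (s + h) - b s) / h) \<longlongrightarrow> 2 * L * (2 * C * ((2 * L * s) ^ j / fact j))) (at_right 0)" for s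
      using b_deriv[of s] unfolding DERIV_def
      by (rule filterlim_mono) (auto simp: at_le)
    have b_cont: "continuous_on {0..} b"
      by (rule DERIV_continuous_on) (rule has_field_derivative_at_within[OF b_deriv])
    have b0: "b 0 = 0" by (simp add: b_def)
    have Gw: "\<bar>G (w s) x\<bar> \<le> 2 * L * (2 * C * ((2 * L * s) ^ j / fact j))" if "0 \<le> s" for s
    proof -
      have "\<bar>T (w s) x\<bar> \<le> 2 * C * ((2 * L * s) ^ j / fact j)"
        using Tk_bounded[where f="w s" and k=1, OF Suc.IH[OF that]] by simp
      then have "\<bar>T (w s) x - w s x\<bar> \<le> 2 * (2 * C * ((2 * L * s) ^ j / fact j))"
        using Suc.IH[OF that, of x] by linarith
      from mult_left_mono[OF this, of L] show ?thesis
        unfolding G_eq abs_mult using L_pos by (simp add: mult_ac)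
    qed
    show ?case
    proof (cases "x \<in> states n")
      case True
      have "w t x - b t \<le> w 0 x - b 0"
      proof (rule right_derivative_nonpos)
        show "((\<lambda>h. (w (s + h) x - b (s + h) - (w s x - b s)) / h) \<longlongrightarrow>
          G (w s) x - 2 * L * (2 * C * ((2 * L * s) ^ j / fact j))) (at_right 0)" if "0 \<le> s" for s
          using tendsto_diff[OF w_deriv[OF that True] b_right[of s]]
          by (simp add: diff_divide_distrib[symmetric] algebra_simps)
        show "G (w s) x - 2 * L * (2 * C * ((2 * L * s) ^ j / fact j)) \<le> 0" if "0 \<le> s" for s
          using Gw[OF that] by (simp add: abs_le_iff)
      qed (use Suc.prems w_cont b_cont in \<open>auto intro!: continuous_intros\<close>)
      moreover have "- w t x - b t \<le> - w 0 x - b 0"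
      proof (rule right_derivative_nonpos)
        show "((\<lambda>h. (- w (s + h) x - b (s + h) - (- w s x - b s)) / h) \<longlongrightarrow>
          - G (w s) x - 2 * L * (2 * C * ((2 * L * s) ^ j / fact j))) (at_right 0)" if "0 \<le> s" for s
          using tendsto_diff[OF tendsto_minus[OF w_deriv[OF that True]] b_right[of s]]
          by (simp add: diff_divide_distrib[symmetric] minus_divide_left algebra_simps)
        show "- G (w s) x - 2 * L * (2 * C * ((2 * L * s) ^ j / fact j)) \<le> 0" if "0 \<le> s" for s
          using Gw[OF that] by (simp add: abs_le_iff)
      qed (use Suc.prems w_cont b_cont in \<open>auto intro!: continuous_intros\<close>)
      ultimately show ?thesis using w0[of x] b0 by (simp add: b_def abs_le_iff)
    next
      case False
      then show ?thesis using Suc.prems C L_pos by (simp add: w_def)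
    qed
  qed
  have "(\<lambda>j. (2 * L * t) ^ j / fact j) \<longlonglongrightarrow> 0"
    by (rule summable_LIMSEQ_zero[OF sums_summable[OF exp_sums]])
  then have "(\<lambda>j. 2 * C * ((2 * L * t) ^ j / fact j)) \<longlonglongrightarrow> 2 * C * 0"
    by (intro tendsto_intros)
  then have "\<bar>w t x\<bar> \<le> 2 * C * 0"
    by (rule LIMSEQ_le_const) (use w_le[OF t] in auto)
  then show ?thesis using x by (simp add: w_def u_def)
qed

end

section \<open>Functionals dominated by a probability mass function\<close>

text \<open>A Radon-Nikodym statement on a countable support: for functions of finite support the
  density is found by linearity, and domination by \<open>p\<close> makes the error of finite
  truncations of \<open>h\<close> vanish.\<close>

lemma dominated_functional_density:
  fixes \<Phi> :: "('a \<Rightarrow> real) \<Rightarrow> real"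
  assumes lin: "\<And>a b f h C. (\<And>x. \<bar>f x\<bar> \<le> C) \<Longrightarrow> (\<And>x. \<bar>h x\<bar> \<le> C) \<Longrightarrow>
      \<Phi> (\<lambda>x. a * f x + b * h x) = a * \<Phi> f + b * \<Phi> h"
    and dom: "\<And>f C. (\<And>x. \<bar>f x\<bar> \<le> C) \<Longrightarrow> \<bar>\<Phi> f\<bar> \<le> measure_pmf.expectation p (\<lambda>x. \<bar>f x\<bar>)"
    and h: "\<And>x. \<bar>h x\<bar> \<le> C"
  shows "\<Phi> h = measure_pmf.expectation p (\<lambda>x. h x * (\<Phi> (indicator {x}) / pmf p x))"
proof -
  define \<rho> where "\<rho> = (\<lambda>x. \<Phi> (indicator {x}) / pmf p x)"
  have C: "0 \<le> C" using h abs_ge_zero order_trans by blast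
  have point: "\<bar>\<Phi> (indicator {x})\<bar> \<le> pmf p x" for x
    using dom[of "indicator {x}" 1] by (simp add: pmf.rep_eq indicator_abs_le_1)
  have \<rho>: "\<bar>\<rho> x\<bar> \<le> 1" for x
    using point[of x] by (simp add: \<rho>_def divide_le_eq_1) (metis order_le_less pmf_nonneg)
  \<comment> \<open>Where \<open>pmf p x = 0\<close>, the quotient is \<open>0\<close> by
    convention, and domination makes \<open>\<Phi> (indicator {x})\<close> vanish too.\<close>
  have \<rho>_point: "pmf p x * \<rho> x = \<Phi> (indicator {x})" for x
    using point[of x] by (auto simp: \<rho>_def)
  define X where "X = from_nat_into (set_pmf p)"
  define F where "F = (\<lambda>n. X ` {..<n::nat})"
  have X: "x \<in> set_pmf p \<Longrightarrow> \<exists>n. x = X n" for x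
    unfolding X_def by (metis countable_set_pmf from_nat_into_surj)
  have fin: "finite (F n)" for n by (simp add: F_def)
  have in_F: "\<forall>\<^sub>F n in sequentially. x \<in> F n" if x: "x \<in> set_pmf p" for x
  proof -
    obtain k where "x = X k" using X[OF x] by blast
    then show ?thesis
      by (intro eventually_sequentiallyI[of "Suc k"]) (auto simp: F_def)
  qed
  have zero: "\<Phi> (\<lambda>_. 0) = 0" using dom[of "\<lambda>_. 0" 0] by simp
  have \<Phi>_fin: "\<Phi> (\<lambda>x. if x \<in> S then h x else 0) = (\<Sum>y\<in>S. h y * \<Phi> (indicator {y}))" if "finite S" for S
    using that
  proof (induction S)
    case (insert y S)
    have "(\<lambda>x. if x \<in> insert y S then h x else 0) =
        (\<lambda>x. 1 * (if x \<in> S then h x else 0) + h y * indicator {y} x)"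
      using insert.hyps by (auto simp: fun_eq_iff indicator_def)
    moreover have "\<Phi> (\<lambda>x. 1 * (if x \<in> S then h x else 0) + h y * indicator {y} x) =
        1 * \<Phi> (\<lambda>x. if x \<in> S then h x else 0) + h y * \<Phi> (indicator {y})"
      by (rule lin[of _ "max C 1"]) (use h C in \<open>auto simp: le_max_iff_disj indicator_def\<close>)
    ultimately show ?case using insert by simp
  qed (simp add: zero)
  define hF where "hF = (\<lambda>n x. if x \<in> F n then h x else 0)"
  have hF: "\<bar>hF n x\<bar> \<le> C" for n x using h C by (simp add: hF_def)
  have lim_h: "(\<lambda>n. hF n x) \<longlonglongrightarrow> h x" if "x \<in> set_pmf p" for x
    by (rule tendsto_eventually, use in_F[OF that] in eventually_elim) (simp add: hF_def)
  have err: "(\<lambda>n. measure_pmf.expectation p (\<lambda>x. \<bar>h x - hF n x\<bar>)) \<longlonglongrightarrow> measure_pmf.expectation p (\<lambda>x. 0)"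
  proof (rule integral_dominated_convergence[where w="\<lambda>_. 2 * C"])
    show "AE x in measure_pmf p. (\<lambda>n. \<bar>h x - hF n x\<bar>) \<longlonglongrightarrow> 0"
      unfolding AE_measure_pmf_iff
    proof
      fix x assume "x \<in> set_pmf p"
      then have "(\<lambda>n. \<bar>h x - hF n x\<bar>) \<longlonglongrightarrow> \<bar>h x - h x\<bar>" by (intro tendsto_intros lim_h)
      then show "(\<lambda>n. \<bar>h x - hF n x\<bar>) \<longlonglongrightarrow> 0" by simp
    qed
    show "AE x in measure_pmf p. norm \<bar>h x - hF n x\<bar> \<le> 2 * C" for n
      using h hF[of n] by (intro AE_I2) (smt (verit) real_norm_def)
  qed auto
  have le: "\<bar>\<Phi> h - \<Phi> (hF n)\<bar> \<le> measure_pmf.expectation p (\<lambda>x. \<bar>h x - hF n x\<bar>)" for n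
  proof -
    have "\<Phi> (\<lambda>x. 1 * h x + (-1) * hF n x) = 1 * \<Phi> h + (-1) * \<Phi> (hF n)"
      by (rule lin[of _ C]) (rule h hF)+
    moreover have "\<bar>1 * h x + (-1) * hF n x\<bar> \<le> 2 * C" for x
      using h[of x] hF[of n x] by simp
    ultimately show ?thesis using dom[of "\<lambda>x. 1 * h x + (-1) * hF n x" "2 * C"] by simp
  qed
  have "(\<lambda>n. \<Phi> h - \<Phi> (hF n)) \<longlonglongrightarrow> 0"
    by (rule Lim_null_comparison[OF always_eventually err[simplified]]) (simp add: le)
  then have 1: "(\<lambda>n. \<Phi> (hF n)) \<longlonglongrightarrow> \<Phi> h"
    using tendsto_diff[OF tendsto_const[of "\<Phi> h"]] by fastforce
  have "(\<lambda>n. measure_pmf.expectation p (\<lambda>x. hF n x * \<rho> x)) \<longlonglongrightarrow> measure_pmf.expectation p (\<lambda>x. h x * \<rho> x)"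
  proof (rule integral_dominated_convergence[where w="\<lambda>_. C"])
    show "AE x in measure_pmf p. (\<lambda>n. hF n x * \<rho> x) \<longlonglongrightarrow> h x * \<rho> x"
      using lim_h by (auto simp: AE_measure_pmf_iff intro!: tendsto_intros)
    show "AE x in measure_pmf p. norm (hF n x * \<rho> x) \<le> C" for n
    proof (intro AE_I2)
      fix x show "norm (hF n x * \<rho> x) \<le> C"
        using mult_mono[OF hF[of n x] \<rho>[of x]] C by (simp add: abs_mult)
    qed
  qed auto
  moreover have "measure_pmf.expectation p (\<lambda>x. hF n x * \<rho> x) = \<Phi> (hF n)" for n
  proof -
    have "measure_pmf.expectation p (\<lambda>x. hF n x * \<rho> x) = (\<Sum>x\<in>F n. pmf p x * (hF n x * \<rho> x))"
      by (subst integral_measure_pmf[OF fin]) (auto simp: hF_def split: if_splits)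
    also have "\<dots> = (\<Sum>x\<in>F n. h x * (pmf p x * \<rho> x))"
      by (intro sum.cong) (auto simp: hF_def)
    also have "\<dots> = \<Phi> (hF n)" by (simp only: \<rho>_point \<Phi>_fin[OF fin] hF_def)
    finally show ?thesis .
  qed
  ultimately have "(\<lambda>n. \<Phi> (hF n)) \<longlonglongrightarrow> measure_pmf.expectation p (\<lambda>x. h x * \<rho> x)" by simp
  from LIMSEQ_unique[OF 1 this] show ?thesis by (simp add: \<rho>_def)
qed

text \<open>Used to turn the escaping mass into a probability distribution, to which uniqueness of
  the stationary distribution applies.\<close>

lemma weighted_pmf:
  fixes \<rho> :: "'a \<Rightarrow> real"
  assumes \<rho>: "\<And>x. 0 \<le> \<rho> x" "\<And>x. \<rho> x \<le> 1" and pos: "0 < measure_pmf.expectation p \<rho>"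
  obtains p' where "set_pmf p' \<subseteq> set_pmf p"
    "\<And>f. measure_pmf.expectation p' f =
       measure_pmf.expectation p (\<lambda>x. f x * \<rho> x) / measure_pmf.expectation p \<rho>"
proof
  define c where "c = measure_pmf.expectation p \<rho>"
  define w where "w = (\<lambda>x. pmf p x * (\<rho> x / c))"
  have c: "0 < c" using pos by (simp add: c_def)
  have "(\<integral>\<^sup>+x. ennreal (w x) \<partial>count_space UNIV) = (\<integral>\<^sup>+x. ennreal (\<rho> x / c) \<partial>measure_pmf p)"
    unfolding nn_integral_measure_pmf
    by (intro nn_integral_cong) (use \<rho> c in \<open>auto simp: w_def ennreal_mult[symmetric]\<close>)
  also have "\<dots> = ennreal (measure_pmf.expectation p (\<lambda>x. \<rho> x / c))"
    by (intro nn_integral_eq_integral integrable_pmf_bounded[of _ _ "1 / c"])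
       (use \<rho> c in \<open>auto simp: divide_right_mono\<close>)
  also have "\<dots> = 1" using c by (simp add: c_def[symmetric])
  finally have w1: "(\<integral>\<^sup>+x. ennreal (w x) \<partial>count_space UNIV) = 1" .
  have w0: "0 \<le> w x" for x using \<rho> c by (simp add: w_def)
  define p' where "p' = embed_pmf w"
  have p': "pmf p' x = w x" for x unfolding p'_def by (rule pmf_embed_pmf[OF w0 w1])
  show "set_pmf p' \<subseteq> set_pmf p"
    by (auto simp: set_pmf_iff p' w_def)
  show "measure_pmf.expectation p' f = measure_pmf.expectation p (\<lambda>x. f x * \<rho> x) / c" for f
  proof -
    have "measure_pmf.expectation p' f = measure_pmf.expectation p (\<lambda>x. f x * \<rho> x / c)"
      unfolding pmf_expectation_eq_infsetsum
      by (intro infsetsum_cong) (auto simp: p' w_def)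
    then show ?thesis by simp
  qed
qed

section \<open>A queue in a monotone random environment\<close>

declare One_nat_def [simp del]

section \<open>Bounded functions\<close>

definition bounded_fun :: "('a \<Rightarrow> real) \<Rightarrow> bool" where
  "bounded_fun f \<longleftrightarrow> (\<exists>C. \<forall>x. \<bar>f x\<bar> \<le> C)"

lemma bounded_funI: "(\<And>x. \<bar>f x\<bar> \<le> C) \<Longrightarrow> bounded_fun f"
  by (auto simp: bounded_fun_def)

lemma bounded_funE:
  assumes "bounded_fun f"
  obtains C where "\<And>x. \<bar>f x\<bar> \<le> C"
  using assms by (auto simp: bounded_fun_def)

lemma bounded_fun_mult:
  assumes "bounded_fun f" "bounded_fun h"
  shows "bounded_fun (\<lambda>x. f x * h x)"
proof -
  obtain C D where CD: "\<And>x. \<bar>f x\<bar> \<le> C" "\<And>x. \<bar>h x\<bar> \<le> D"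
    using assms by (auto elim!: bounded_funE)
  have "\<bar>f x * h x\<bar> \<le> C * D" for x
    unfolding abs_mult
    by (rule mult_mono[OF CD order_trans[OF abs_ge_zero CD(1)[of x]] abs_ge_zero])
  then show ?thesis by (rule bounded_funI)
qed

lemma bounded_fun_linear:
  assumes "bounded_fun f" "bounded_fun h"
  shows "bounded_fun (\<lambda>x. a * f x + b * h x)"
proof -
  obtain C D where CD: "\<And>x. \<bar>f x\<bar> \<le> C" "\<And>x. \<bar>h x\<bar> \<le> D"
    using assms by (auto elim!: bounded_funE)
  have "\<bar>a * f x + b * h x\<bar> \<le> \<bar>a\<bar> * C + \<bar>b\<bar> * D" for x
    by (rule order_trans[OF abs_triangle_ineq])
       (auto simp: abs_mult intro!: add_mono mult_left_mono CD)
  then show ?thesis by (rule bounded_funI)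
qed

lemma integrable_bounded_fun: "bounded_fun f \<Longrightarrow> integrable (measure_pmf p) f"
  by (auto elim!: bounded_funE intro: integrable_pmf_bounded)

lemma bounded_fun_abs: "bounded_fun f \<Longrightarrow> bounded_fun (\<lambda>x. \<bar>f x\<bar>)"
  by (auto simp: bounded_fun_def)

lemma bounded_fun_const: "bounded_fun (\<lambda>_. c)"
  by (auto simp: bounded_fun_def)

lemma (in queue) bounded_fun_Tk: "bounded_fun f \<Longrightarrow> bounded_fun ((T ^^ k) f)"
  unfolding bounded_fun_def using Tk_bounded by metis

lemma (in queue) bounded_fun_T: "bounded_fun f \<Longrightarrow> bounded_fun (T f)"
  using bounded_fun_Tk[of f "Suc 0"] by simp

definition depends_on :: "nat set \<Rightarrow> ((nat \<Rightarrow> nat) \<Rightarrow> real) \<Rightarrow> bool" where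
  "depends_on A f \<longleftrightarrow> (\<forall>x y. (\<forall>i\<in>A. x i = y i) \<longrightarrow> f x = f y)"

lemma depends_onD: "depends_on A f \<Longrightarrow> (\<And>i. i \<in> A \<Longrightarrow> x i = y i) \<Longrightarrow> f x = f y"
  by (auto simp: depends_on_def)

text \<open>
  The environment is the network of the queues \<open>1, \<dots>, m\<close>, with stationary distribution \<open>\<pi>\<close>.
  Queue \<open>m + 1\<close> is served at rate \<open>psi\<close> of the environment as long as its length exceeds \<open>r\<close>.
\<close>

locale driven_queue =
  fixes m :: nat and lam :: "nat \<Rightarrow> real" and ell :: "nat \<Rightarrow> (nat \<Rightarrow> nat) \<Rightarrow> real"
    and psi :: "(nat \<Rightarrow> nat) \<Rightarrow> real" and \<pi> :: "(nat \<Rightarrow> nat) pmf" and L B :: real and r :: nat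
  assumes lam_pos: "i \<in> {1..Suc m} \<Longrightarrow> 0 < lam i"
    and ell_nonneg: "i \<in> {1..m} \<Longrightarrow> 0 \<le> ell i x"
    and ell_le: "i \<in> {1..m} \<Longrightarrow> ell i x \<le> B"
    and ell_antitone: "antitone_rates {1..m} ell"
    and psi_nonneg: "0 \<le> psi x"
    and psi_le: "psi x \<le> B"
    and psi_antitone: "(\<And>j. j \<in> {1..m} \<Longrightarrow> x j \<le> y j) \<Longrightarrow> psi y \<le> psi x"
    and L_pos: "0 < L"
    and L_ge: "(\<Sum>i\<in>{1..Suc m}. lam i + B) \<le> L"
    and pi_states: "set_pmf \<pi> \<subseteq> states m"
    and pi_stationary: "bounded_fun f \<Longrightarrow>
      measure_pmf.expectation \<pi> (step {1..m} lam ell L f) = measure_pmf.expectation \<pi> f"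
    and pi_unique: "set_pmf p \<subseteq> states m \<Longrightarrow>
      (\<And>f. bounded_fun f \<Longrightarrow>
        measure_pmf.expectation p (step {1..m} lam ell L f) = measure_pmf.expectation p f) \<Longrightarrow> p = \<pi>"
    and drift: "lam (Suc m) < measure_pmf.expectation \<pi> psi"
begin

section \<open>The joint chain of the environment and queue \<open>m + 1\<close>\<close>

text \<open>With service switched off at and below \<open>r\<close>, the queue started at
  \<open>r\<close> never falls below it. Moreover, \<open>psi\<close> has to be a lower bound for
  the true service rate only at lengths above \<open>r\<close>.\<close>

definition rates :: "nat \<Rightarrow> (nat \<Rightarrow> nat) \<Rightarrow> real" where
  "rates i x = (if i = Suc m then (if r < x (Suc m) then psi x else 0) else ell i x)"

lemma B_nonneg: "0 \<le> B"
  using psi_nonneg psi_le order_trans by blast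

sublocale I: queue "{1..m}" lam ell L B
proof
  have "(\<Sum>i\<in>{1..m}. lam i + B) \<le> (\<Sum>i\<in>{1..Suc m}. lam i + B)"
    using lam_pos[of "Suc m"] B_nonneg by simp
  then show "(\<Sum>i\<in>{1..m}. lam i + B) \<le> L" using L_ge by linarith
qed (use lam_pos ell_nonneg ell_le L_pos in \<open>auto intro: less_imp_le\<close>)

sublocale J: queue "{1..Suc m}" lam rates L B
proof
  show "0 \<le> rates i x" "rates i x \<le> B" if "i \<in> {1..Suc m}" for i x
    using that psi_nonneg psi_le ell_nonneg ell_le B_nonneg by (auto simp: rates_def le_Suc_eq)
qed (use lam_pos L_pos L_ge in \<open>auto intro: less_imp_le\<close>)

lemma rates_antitone: "antitone_rates {1..Suc m} rates"
  using ell_antitone psi_antitone psi_nonneg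
  by (auto simp: antitone_rates_def rates_def le_Suc_eq)

text \<open>Restriction turns any configuration into an element of \<open>states m\<close>, so that
  even the indicator of a single state becomes a function of the environment coordinates of the
  joint chain.\<close>

definition lift :: "((nat \<Rightarrow> nat) \<Rightarrow> real) \<Rightarrow> (nat \<Rightarrow> nat) \<Rightarrow> real" where
  "lift h x = h (restrict x {1..m})"

definition tail :: "nat \<Rightarrow> (nat \<Rightarrow> nat) \<Rightarrow> real" where
  "tail c x = of_bool (c < x (Suc m))"

text \<open>The expectation after \<open>k\<close> steps of the joint chain, with the environment
  started from \<open>\<pi>\<close> and queue \<open>m + 1\<close> started at
  \<open>r\<close>.\<close>

definition E :: "nat \<Rightarrow> ((nat \<Rightarrow> nat) \<Rightarrow> real) \<Rightarrow> real" where
  "E k f = measure_pmf.expectation \<pi> (\<lambda>y. (J.T ^^ k) f (y(Suc m := r)))"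

lemma lift_depends: "depends_on {1..m} (lift h)"
  unfolding depends_on_def lift_def by (metis restrict_ext)

lemma lift_eq: "depends_on {1..m} h \<Longrightarrow> lift h = h"
  by (auto simp: lift_def fun_eq_iff intro!: depends_onD)

lemma lift_states: "y \<in> states m \<Longrightarrow> lift h y = h y"
  by (simp add: lift_def states_def PiE_restrict)

lemma bounded_lift: "bounded_fun h \<Longrightarrow> bounded_fun (lift h)"
  by (auto simp: bounded_fun_def lift_def)

lemma psi_depends: "depends_on {1..m} psi"
  by (auto simp: depends_on_def intro!: antisym psi_antitone)

lemma bounded_tail: "bounded_fun (tail c)"
  by (rule bounded_funI[of _ 1]) (simp add: tail_def)

lemma bounded_psi: "bounded_fun psi"
  by (rule bounded_funI[of _ B]) (simp add: psi_nonneg psi_le)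

lemma expectation_pi_cong:
  "(\<And>y. y \<in> states m \<Longrightarrow> f y = h y) \<Longrightarrow> measure_pmf.expectation \<pi> f = measure_pmf.expectation \<pi> h"
  using pi_states by (intro integral_cong_AE) (auto simp: AE_measure_pmf_iff)

lemma J_T_eq:
  "J.T f x = f x + (I.G f x + lam (Suc m) * (f (x(Suc m := x (Suc m) + 1)) - f x)
     + rates (Suc m) x * (f (x(Suc m := x (Suc m) - 1)) - f x)) / L"
proof -
  have "(\<Sum>i\<in>{1..m}. lam i * (f (x(i := x i + 1)) - f x) + rates i x * (f (x(i := x i - 1)) - f x))
      = I.G f x"
    unfolding generator_def by (intro sum.cong) (auto simp: rates_def)
  then show ?thesis
    by (simp add: step_def generator_def)
qed

lemma J_T_depends:
  assumes "depends_on {1..m} f"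
  shows "J.T f = I.T f"
proof
  fix x
  have "f (x(Suc m := c)) = f x" for c by (rule depends_onD[OF assms]) auto
  then show "J.T f x = I.T f x" unfolding J_T_eq by (simp add: step_def)
qed

lemma I_T_depends:
  assumes f: "depends_on {1..m} f"
  shows "depends_on {1..m} (I.T f)"
  unfolding depends_on_def
proof (intro allI impI)
  fix x y :: "nat \<Rightarrow> nat" assume xy: "\<forall>i\<in>{1..m}. x i = y i"
  have "ell i x = ell i y" if "i \<in> {1..m}" for i
    using ell_antitone xy that unfolding antitone_rates_def by (intro antisym) auto
  moreover have "f x = f y" "f (x(i := x i + 1)) = f (y(i := y i + 1))"
    "f (x(i := x i - 1)) = f (y(i := y i - 1))" if "i \<in> {1..m}" for i
    by (rule depends_onD[OF f]; use xy that in auto)+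
  moreover have "f x = f y" by (rule depends_onD[OF f]) (use xy in auto)
  ultimately show "I.T f x = I.T f y"
    unfolding step_def generator_def by (auto intro!: sum.cong)
qed

text \<open>The environment and queue \<open>m + 1\<close> never jump together, so a product rule
  without cross term holds.\<close>

lemma J_T_tail:
  assumes "depends_on {1..m} h"
  shows "J.T (\<lambda>x. h x * tail c x) x = I.T h x * tail c x +
    h x * (lam (Suc m) * (tail c (x(Suc m := x (Suc m) + 1)) - tail c x)
      + rates (Suc m) x * (tail c (x(Suc m := x (Suc m) - 1)) - tail c x)) / L"
proof -
  have h: "h (x(Suc m := c)) = h x" for c by (rule depends_onD[OF assms]) auto
  have "I.G (\<lambda>x. h x * tail c x) x = I.G h x * tail c x"
    unfolding generator_def sum_distrib_right
    by (intro sum.cong) (auto simp: tail_def algebra_simps)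
  then show ?thesis
    unfolding J_T_eq by (simp add: step_def h algebra_simps add_divide_distrib diff_divide_distrib)
qed

lemma bounded_start: "bounded_fun f \<Longrightarrow> bounded_fun (\<lambda>y. (J.T ^^ k) f (y(Suc m := r)))"
  using J.bounded_fun_Tk[of f k] by (auto simp: bounded_fun_def)

lemma E_linear:
  assumes "bounded_fun f" "bounded_fun h"
  shows "E k (\<lambda>x. a * f x + b * h x) = a * E k f + b * E k h"
  unfolding E_def J.Tk_linear
  using integrable_bounded_fun[OF bounded_start[OF assms(1)]]
    integrable_bounded_fun[OF bounded_start[OF assms(2)]]
  by simp

lemma E_mono:
  assumes "bounded_fun f" "bounded_fun h" "\<And>x. f x \<le> h x"
  shows "E k f \<le> E k h"
  unfolding E_def
  by (intro integral_mono integrable_bounded_fun bounded_start J.Tk_mono assms)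

lemma E_abs:
  assumes "bounded_fun f"
  shows "\<bar>E k f\<bar> \<le> E k (\<lambda>x. \<bar>f x\<bar>)"
proof -
  have "E k f \<le> E k (\<lambda>x. \<bar>f x\<bar>)"
    by (intro E_mono assms bounded_fun_abs) auto
  moreover have "E k (\<lambda>x. (-1) * f x + 0 * f x) \<le> E k (\<lambda>x. \<bar>f x\<bar>)"
    by (intro E_mono bounded_fun_linear assms bounded_fun_abs) auto
  ultimately show ?thesis
    using E_linear[OF assms assms, of k "-1" 0] by simp
qed

lemma E_Suc: "E (Suc k) f = E k (J.T f)"
  by (simp add: E_def funpow_swap1)

text \<open>The environment evolves without regard to queue \<open>m + 1\<close>, so it remains
  stationary along the joint chain.\<close>

lemma E_environment:
  assumes "depends_on {1..m} f" "bounded_fun f"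
  shows "E k f = measure_pmf.expectation \<pi> f"
  using assms
proof (induction k arbitrary: f)
  case 0
  have "f (y(Suc m := r)) = f y" for y by (rule depends_onD[OF 0(1)]) auto
  then show ?case by (simp add: E_def)
next
  case (Suc k)
  have "E (Suc k) f = E k (I.T f)" by (simp add: E_Suc J_T_depends[OF Suc.prems(1)])
  also have "\<dots> = measure_pmf.expectation \<pi> (I.T f)"
    by (intro Suc.IH I_T_depends I.bounded_fun_T Suc.prems)
  also have "\<dots> = measure_pmf.expectation \<pi> f" by (rule pi_stationary[OF Suc.prems(2)])
  finally show ?case .
qed

text \<open>
  Queue \<open>m + 1\<close> starts at its lower bound \<open>r\<close> and the environment is stationary, so the first
  step can only increase the law.
\<close>

lemma E_increasing:
  assumes f: "mono_coords {1..Suc m} f" "bounded_fun f"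
  shows "E k f \<le> E (Suc k) f"
proof -
  define F where "F = (J.T ^^ k) f"
  have F: "mono_coords {1..Suc m} F" "bounded_fun F"
    unfolding F_def by (intro J.Tk_mono_coords J.bounded_fun_Tk f rates_antitone)+
  define F0 where "F0 = (\<lambda>y. F (y(Suc m := r)))"
  have F0: "bounded_fun F0" using F(2) by (auto simp: F0_def bounded_fun_def)
  \<comment> \<open>At length \<open>r\<close> service is off, so the joint operator differs from
    the environment operator only by the effect of an arrival at queue \<open>m + 1\<close>.\<close>
  have "I.T F0 y \<le> J.T F (y(Suc m := r))" for y
  proof -
    have "ell i (y(Suc m := r)) = ell i y" if "i \<in> {1..m}" for i
      using ell_antitone that unfolding antitone_rates_def by (intro antisym) auto
    then have "I.G F0 y = I.G F (y(Suc m := r))"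
      unfolding generator_def by (intro sum.cong) (auto simp: F0_def fun_upd_twist)
    moreover have "F (y(Suc m := r)) \<le> F (y(Suc m := r + 1))"
      by (rule mono_coordsD[OF F(1)]) auto
    ultimately show ?thesis
      unfolding J_T_eq using lam_pos[of "Suc m"] L_pos
      by (simp add: step_def F0_def rates_def divide_right_mono)
  qed
  then have "measure_pmf.expectation \<pi> (I.T F0) \<le> measure_pmf.expectation \<pi> (\<lambda>y. J.T F (y(Suc m := r)))"
    using bounded_start[OF F(2), of "Suc 0"]
    by (intro integral_mono integrable_bounded_fun I.bounded_fun_T F0) auto
  then show ?thesis
    using pi_stationary[OF F0] by (simp add: E_def F_def F0_def)
qed

section \<open>The density of the environment on the event that queue \<open>m + 1\<close> is long,
  and its limits\<close>

text \<open>The density with respect to \<open>\<pi>\<close> of the environment after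
  \<open>k\<close> steps, on the event that queue \<open>m + 1\<close> exceeds \<open>c\<close>. At
  states of mass \<open>0\<close> it is \<open>0\<close>, the value of a division by
  \<open>0\<close>.\<close>

definition rho :: "nat \<Rightarrow> nat \<Rightarrow> (nat \<Rightarrow> nat) \<Rightarrow> real" where
  "rho c k y = E k (\<lambda>x. lift (indicator {y}) x * tail c x) / pmf \<pi> y"

text \<open>Since \<open>tail c\<close> is at most \<open>1\<close> and the environment is
  stationary, the functional is dominated by \<open>\<pi>\<close> and hence has a density.\<close>

lemma E_tail_density:
  assumes "bounded_fun h"
  shows "E k (\<lambda>x. lift h x * tail c x) = measure_pmf.expectation \<pi> (\<lambda>y. h y * rho c k y)"
proof -
  obtain C where C: "\<And>x. \<bar>h x\<bar> \<le> C" using assms by (rule bounded_funE) blast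
  show ?thesis
    unfolding rho_def
  proof (rule dominated_functional_density[where C=C and \<Phi>="\<lambda>h. E k (\<lambda>x. lift h x * tail c x)"])
    fix a b D and f h :: "(nat \<Rightarrow> nat) \<Rightarrow> real" assume "\<And>x. \<bar>f x\<bar> \<le> D" "\<And>x. \<bar>h x\<bar> \<le> D"
    then have "bounded_fun f" "bounded_fun h" by (auto intro: bounded_funI)
    then have "E k (\<lambda>x. a * (lift f x * tail c x) + b * (lift h x * tail c x)) =
        a * E k (\<lambda>x. lift f x * tail c x) + b * E k (\<lambda>x. lift h x * tail c x)"
      by (intro E_linear bounded_fun_mult bounded_lift bounded_tail)
    then show "E k (\<lambda>x. lift (\<lambda>x. a * f x + b * h x) x * tail c x) =
        a * E k (\<lambda>x. lift f x * tail c x) + b * E k (\<lambda>x. lift h x * tail c x)"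
      by (simp add: lift_def algebra_simps)
  next
    fix f :: "(nat \<Rightarrow> nat) \<Rightarrow> real" and D assume "\<And>x. \<bar>f x\<bar> \<le> D"
    then have f: "bounded_fun f" by (auto intro: bounded_funI)
    have "\<bar>E k (\<lambda>x. lift f x * tail c x)\<bar> \<le> E k (\<lambda>x. \<bar>lift f x * tail c x\<bar>)"
      by (intro E_abs bounded_fun_mult bounded_lift bounded_tail f)
    also have "\<dots> \<le> E k (lift (\<lambda>x. \<bar>f x\<bar>))"
      by (intro E_mono bounded_fun_mult bounded_fun_abs bounded_lift bounded_tail f)
         (auto simp: lift_def tail_def)
    also have "\<dots> = measure_pmf.expectation \<pi> (lift (\<lambda>x. \<bar>f x\<bar>))"
      by (intro E_environment lift_depends bounded_lift bounded_fun_abs f)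
    also have "\<dots> = measure_pmf.expectation \<pi> (\<lambda>x. \<bar>f x\<bar>)"
      by (rule expectation_pi_cong) (rule lift_states)
    finally show "\<bar>E k (\<lambda>x. lift f x * tail c x)\<bar> \<le> measure_pmf.expectation \<pi> (\<lambda>x. \<bar>f x\<bar>)" .
  qed (rule C)
qed

lemma rho_bounds: "0 \<le> rho c k y" "rho c k y \<le> 1"
proof -
  let ?f = "\<lambda>x. lift (indicator {y}) x * tail c x"
  have b: "bounded_fun (indicator {y} :: (nat \<Rightarrow> nat) \<Rightarrow> real)"
    by (rule bounded_funI[of _ 1]) (simp add: indicator_abs_le_1)
  have "E k (\<lambda>_. 0) \<le> E k ?f"
    by (intro E_mono bounded_fun_mult bounded_lift bounded_tail bounded_fun_const b)
       (auto simp: lift_def tail_def)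
  then show "0 \<le> rho c k y" by (simp add: E_def rho_def)
  have "E k ?f \<le> E k (lift (indicator {y}))"
    by (intro E_mono bounded_fun_mult bounded_lift bounded_tail b) (auto simp: lift_def tail_def)
  also have "\<dots> = measure_pmf.expectation \<pi> (lift (indicator {y}))"
    by (intro E_environment lift_depends bounded_lift b)
  also have "\<dots> = measure_pmf.expectation \<pi> (indicator {y})"
    by (rule expectation_pi_cong) (rule lift_states)
  also have "\<dots> = pmf \<pi> y" by (simp add: pmf.rep_eq)
  finally show "rho c k y \<le> 1"
    unfolding rho_def by (simp add: divide_le_eq_1) (metis order_le_less pmf_nonneg)
qed

lemma rho_antimono:
  assumes "c \<le> d"
  shows "rho d k y \<le> rho c k y"
  unfolding rho_def
  by (intro divide_right_mono E_mono bounded_fun_mult bounded_lift bounded_tail)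
     (use assms in \<open>auto simp: lift_def tail_def intro!: bounded_funI[of _ 1]\<close>)

lemma E_convergent:
  assumes f: "mono_coords {1..Suc m} f" "bounded_fun f"
  shows "convergent (\<lambda>k. E k f)"
proof -
  obtain C where C: "\<And>x. \<bar>f x\<bar> \<le> C" using f(2) by (rule bounded_funE) blast
  have "norm (E k f) \<le> C" for k
    unfolding E_def real_norm_def
    by (intro abs_expectation_le J.Tk_bounded C)
  moreover have "incseq (\<lambda>k. E k f)" by (intro incseq_SucI E_increasing f)
  ultimately show ?thesis
    by (intro Bseq_monoseq_convergent BseqI' incseq_imp_monoseq) auto
qed

text \<open>The indicator of a point is the difference of the indicators of two up-sets.\<close>

lemma rho_convergent: "convergent (\<lambda>k. rho c k y)"
proof (cases "y \<in> states m")
  case True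
  define U V :: "(nat \<Rightarrow> nat) \<Rightarrow> real"
    where "U = (\<lambda>x. of_bool ((\<forall>i\<in>{1..m}. y i \<le> x i) \<and> c < x (Suc m)))"
      and "V = (\<lambda>x. of_bool ((\<forall>i\<in>{1..m}. y i \<le> x i) \<and> (\<exists>i\<in>{1..m}. y i < x i) \<and> c < x (Suc m)))"
  have bd: "bounded_fun U" "bounded_fun V"
    by (auto simp: U_def V_def intro!: bounded_funI[of _ 1])
  have split: "(\<forall>i\<in>{1..m}. x i \<le> z i) \<and> x (Suc m) \<le> z (Suc m)"
    if "\<forall>i\<in>{1..Suc m}. x i \<le> (z i :: nat)" for x z
    using that by auto
  have "mono_coords {1..Suc m} U"
    unfolding mono_coords_def
  proof (intro allI impI)
    fix x z :: "nat \<Rightarrow> nat" assume "\<forall>i\<in>{1..Suc m}. x i \<le> z i"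
    from split[OF this] show "U x \<le> U z"
      unfolding U_def of_bool_less_eq_iff by (meson less_le_trans order_trans)
  qed
  moreover have "mono_coords {1..Suc m} V"
    unfolding mono_coords_def
  proof (intro allI impI)
    fix x z :: "nat \<Rightarrow> nat" assume "\<forall>i\<in>{1..Suc m}. x i \<le> z i"
    from split[OF this] show "V x \<le> V z"
      unfolding V_def of_bool_less_eq_iff by (meson less_le_trans order_trans)
  qed
  ultimately have "convergent (\<lambda>k. E k U)" "convergent (\<lambda>k. E k V)"
    by (auto intro: E_convergent bd)
  then have "convergent (\<lambda>k. 1 * E k U + (-1) * E k V)"
    by (intro convergent_add convergent_mult convergent_const)
  moreover have "1 * U x + (-1) * V x = lift (indicator {y}) x * tail c x" for x
  proof -
    have "restrict x {1..m} = y \<longleftrightarrow> (\<forall>i\<in>{1..m}. y i = x i)"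
      using True by (auto simp: states_def PiE_iff fun_eq_iff restrict_def extensional_def)
    then have "lift (indicator {y}) x = of_bool (\<forall>i\<in>{1..m}. y i = x i)"
      by (simp add: lift_def indicator_def)
    then show ?thesis by (auto simp: U_def V_def tail_def order.strict_iff_order)
  qed
  ultimately have "convergent (\<lambda>k. E k (\<lambda>x. lift (indicator {y}) x * tail c x))"
    using E_linear[OF bd, of _ 1 "-1"] by simp
  then show ?thesis
    unfolding rho_def divide_inverse by (intro convergent_mult convergent_const)
next
  case False
  then have "pmf \<pi> y = 0" using pi_states by (auto simp: set_pmf_iff)
  then show ?thesis by (simp add: rho_def convergent_const)
qed

definition rho_lim :: "nat \<Rightarrow> (nat \<Rightarrow> nat) \<Rightarrow> real" where
  "rho_lim c y = lim (\<lambda>k. rho c k y)"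

text \<open>Time tends to infinity before the level \<open>c\<close> does; the result is the density
  of the escaping mass with respect to \<open>\<pi>\<close>.\<close>

definition rho_inf :: "(nat \<Rightarrow> nat) \<Rightarrow> real" where
  "rho_inf y = lim (\<lambda>c. rho_lim c y)"

lemma rho_lim: "(\<lambda>k. rho c k y) \<longlonglongrightarrow> rho_lim c y"
  unfolding rho_lim_def using rho_convergent by (simp add: convergent_LIMSEQ_iff)

lemma rho_lim_bounds: "0 \<le> rho_lim c y" "rho_lim c y \<le> 1"
  by (rule LIMSEQ_le_const[OF rho_lim] LIMSEQ_le_const2[OF rho_lim]; use rho_bounds in blast)+

lemma rho_lim_antimono: "c \<le> d \<Longrightarrow> rho_lim d y \<le> rho_lim c y"
  by (rule LIMSEQ_le[OF rho_lim rho_lim]) (auto intro: rho_antimono)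

lemma rho_inf: "(\<lambda>c. rho_lim c y) \<longlonglongrightarrow> rho_inf y"
proof -
  have "convergent (\<lambda>c. rho_lim c y)"
    by (intro Bseq_monoseq_convergent BseqI'[of _ 1])
       (use rho_lim_bounds in \<open>auto simp: monoseq_def intro!: rho_lim_antimono\<close>)
  then show ?thesis by (simp add: rho_inf_def convergent_LIMSEQ_iff)
qed

lemma rho_inf_bounds: "0 \<le> rho_inf y" "rho_inf y \<le> 1"
  by (rule LIMSEQ_le_const[OF rho_inf] LIMSEQ_le_const2[OF rho_inf]; use rho_lim_bounds in blast)+

lemma expectation_mult_tendsto:
  assumes h: "bounded_fun h" and \<rho>: "\<And>k y. 0 \<le> \<rho> k y" "\<And>k y. \<rho> k y \<le> (1::real)"
    and lim: "\<And>y. (\<lambda>k. \<rho> k y) \<longlonglongrightarrow> \<rho>' y"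
  shows "(\<lambda>k. measure_pmf.expectation \<pi> (\<lambda>y. h y * \<rho> k y)) \<longlonglongrightarrow> measure_pmf.expectation \<pi> (\<lambda>y. h y * \<rho>' y)"
proof -
  obtain C where C: "\<And>x. \<bar>h x\<bar> \<le> C" using h by (rule bounded_funE) blast
  have "\<bar>h y\<bar> * \<bar>\<rho> k y\<bar> \<le> C * 1" for k y
    by (rule mult_mono) (use C[of y] \<rho>[of k y] in auto)
  then show ?thesis
    by (intro integral_dominated_convergence[where w="\<lambda>_. C"])
       (auto simp: abs_mult intro!: tendsto_intros lim)
qed

text \<open>The long-run value of \<open>E k (\<lambda>x. lift h x * tail c x)\<close>.\<close>

definition N :: "nat \<Rightarrow> ((nat \<Rightarrow> nat) \<Rightarrow> real) \<Rightarrow> real" where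
  "N c h = measure_pmf.expectation \<pi> (\<lambda>y. h y * rho_lim c y)"

lemma E_tendsto_N: "bounded_fun h \<Longrightarrow> (\<lambda>k. E k (\<lambda>x. lift h x * tail c x)) \<longlonglongrightarrow> N c h"
  unfolding N_def E_tail_density
  by (rule expectation_mult_tendsto) (auto intro: rho_bounds rho_lim)

lemma N_tendsto: "bounded_fun h \<Longrightarrow>
    (\<lambda>c. N c h) \<longlonglongrightarrow> measure_pmf.expectation \<pi> (\<lambda>y. h y * rho_inf y)"
  unfolding N_def
  by (rule expectation_mult_tendsto) (auto intro: rho_lim_bounds rho_inf)

lemma E_tail_tendsto: "(\<lambda>k. E k (tail c)) \<longlonglongrightarrow> N c (\<lambda>_. 1)"
  using E_tendsto_N[OF bounded_fun_const[of 1], of c] by (simp add: lift_def)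

text \<open>One step of the joint chain acts on \<open>lift h x * tail c x\<close> as a step of the
  environment, up to a boundary term near level \<open>c\<close>. In the long run the mass near
  level \<open>c\<close> vanishes as \<open>c\<close> grows.\<close>

lemma rho_inf_invariant:
  assumes h: "bounded_fun h"
  shows "measure_pmf.expectation \<pi> (\<lambda>y. I.T (lift h) y * rho_inf y) =
    measure_pmf.expectation \<pi> (\<lambda>y. h y * rho_inf y)"
proof -
  obtain C where C: "\<And>x. \<bar>h x\<bar> \<le> C" using h by (rule bounded_funE) blast
  have C0: "0 \<le> C" using C abs_ge_zero order_trans by blast
  define h' where "h' = I.T (lift h)"
  have h': "bounded_fun h'" "lift h' = h'"
    unfolding h'_def by (intro I.bounded_fun_T bounded_lift h lift_eq I_T_depends lift_depends)+
  define K where "K = C * (lam (Suc m) + B) / L"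
  have K0: "0 \<le> K"
    using C0 lam_pos[of "Suc m"] B_nonneg L_pos by (simp add: K_def)
  have le: "\<bar>N (Suc d) h - N (Suc d) h'\<bar> \<le> K * (N d (\<lambda>_. 1) - N (d + 2) (\<lambda>_. 1))" for d
  proof -
    \<comment> \<open>The boundary term at level \<open>Suc d\<close>: an arrival crosses the level
      only from length \<open>d + 1\<close> and a departure only from \<open>d + 2\<close>, so the
      term is supported where \<open>tail d - tail (d + 2)\<close> is \<open>1\<close>.\<close>
    define R where "R = (\<lambda>x. lift h x * (lam (Suc m) * (tail (Suc d) (x(Suc m := x (Suc m) + 1)) - tail (Suc d) x)
      + rates (Suc m) x * (tail (Suc d) (x(Suc m := x (Suc m) - 1)) - tail (Suc d) x)) / L)"
    have R_le: "\<bar>R x\<bar> \<le> K * tail d x + (- K) * tail (d + 2) x" for x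
    proof -
      let ?u = "lam (Suc m) * (tail (Suc d) (x(Suc m := x (Suc m) + 1)) - tail (Suc d) x)
        + rates (Suc m) x * (tail (Suc d) (x(Suc m := x (Suc m) - 1)) - tail (Suc d) x)"
      have "\<bar>?u\<bar> \<le> \<bar>lam (Suc m)\<bar> * \<bar>tail (Suc d) (x(Suc m := x (Suc m) + 1)) - tail (Suc d) x\<bar>
        + \<bar>rates (Suc m) x\<bar> * \<bar>tail (Suc d) (x(Suc m := x (Suc m) - 1)) - tail (Suc d) x\<bar>"
        by (rule order_trans[OF abs_triangle_ineq]) (simp add: abs_mult)
      also have "\<dots> \<le> lam (Suc m) * (tail d x - tail (d + 2) x) + B * (tail d x - tail (d + 2) x)"
        by (intro add_mono mult_mono)
           (use lam_pos[of "Suc m"] J.g_nonneg[of "Suc m" x] J.g_le[of "Suc m" x] B_nonneg in \<open>auto simp: tail_def\<close>)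
      finally have u: "\<bar>?u\<bar> \<le> (lam (Suc m) + B) * (tail d x - tail (d + 2) x)"
        by (simp add: algebra_simps)
      have "\<bar>lift h x * ?u\<bar> \<le> C * ((lam (Suc m) + B) * (tail d x - tail (d + 2) x))"
        unfolding abs_mult by (intro mult_mono u) (use C C0 in \<open>auto simp: lift_def\<close>)
      then have "\<bar>R x\<bar> \<le> C * ((lam (Suc m) + B) * (tail d x - tail (d + 2) x)) / L"
        using L_pos by (simp add: R_def divide_right_mono)
      then show ?thesis by (simp add: K_def algebra_simps diff_divide_distrib)
    qed
    have R: "bounded_fun R"
    proof (rule bounded_funI)
      show "\<bar>R x\<bar> \<le> K" for x
        using R_le[of x] K0 by (auto simp: tail_def of_bool_def split: if_splits)
    qed
    have R_bound: "bounded_fun (\<lambda>x. K * tail d x + (- K) * tail (d + 2) x)"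
      by (intro bounded_fun_linear bounded_tail)
    have diff: "\<bar>E (Suc k) (\<lambda>x. lift h x * tail (Suc d) x) - E k (\<lambda>x. lift h' x * tail (Suc d) x)\<bar>
        \<le> K * E k (tail d) + (- K) * E k (tail (d + 2))" for k
    proof -
      have "J.T (\<lambda>x. lift h x * tail (Suc d) x) = (\<lambda>x. 1 * (lift h' x * tail (Suc d) x) + 1 * R x)"
        unfolding h'(2) unfolding h'_def R_def by (intro ext) (subst J_T_tail[OF lift_depends], simp)
      then have "E (Suc k) (\<lambda>x. lift h x * tail (Suc d) x) =
          1 * E k (\<lambda>x. lift h' x * tail (Suc d) x) + 1 * E k R"
        unfolding E_Suc by (simp only:) (intro E_linear bounded_fun_mult bounded_lift bounded_tail h' R)
      moreover have "\<bar>E k R\<bar> \<le> E k (\<lambda>x. K * tail d x + (- K) * tail (d + 2) x)"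
        by (rule order_trans[OF E_abs[OF R] E_mono[OF bounded_fun_abs[OF R] R_bound R_le]])
      ultimately show ?thesis by (simp only: E_linear[OF bounded_tail bounded_tail])
    qed
    have "(\<lambda>k. \<bar>E (Suc k) (\<lambda>x. lift h x * tail (Suc d) x) - E k (\<lambda>x. lift h' x * tail (Suc d) x)\<bar>)
        \<longlonglongrightarrow> \<bar>N (Suc d) h - N (Suc d) h'\<bar>"
      by (intro tendsto_rabs tendsto_diff LIMSEQ_Suc E_tendsto_N h h')
    moreover have "(\<lambda>k. K * E k (tail d) + (- K) * E k (tail (d + 2)))
        \<longlonglongrightarrow> K * N d (\<lambda>_. 1) + (- K) * N (d + 2) (\<lambda>_. 1)"
      by (intro tendsto_intros E_tail_tendsto)
    ultimately have "\<bar>N (Suc d) h - N (Suc d) h'\<bar> \<le> K * N d (\<lambda>_. 1) + (- K) * N (d + 2) (\<lambda>_. 1)"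
      by (rule LIMSEQ_le) (use diff in blast)
    then show ?thesis by (simp add: algebra_simps)
  qed
  \<comment> \<open>\<open>N d (\<lambda>_. 1)\<close> and \<open>N (d + 2) (\<lambda>_. 1)\<close>
    share the limit \<open>?p\<close>, so the bound on the boundary term tends to
    \<open>0\<close>.\<close>
  let ?p = "measure_pmf.expectation \<pi> (\<lambda>y. 1 * rho_inf y)"
  have "(\<lambda>d. \<bar>N (Suc d) h - N (Suc d) h'\<bar>) \<longlonglongrightarrow>
      \<bar>measure_pmf.expectation \<pi> (\<lambda>y. h y * rho_inf y) - measure_pmf.expectation \<pi> (\<lambda>y. h' y * rho_inf y)\<bar>"
    by (intro tendsto_rabs tendsto_diff LIMSEQ_Suc N_tendsto h h')
  moreover have "(\<lambda>d. K * (N d (\<lambda>_. 1) - N (d + 2) (\<lambda>_. 1))) \<longlonglongrightarrow> K * (?p - ?p)"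
    by (intro tendsto_intros LIMSEQ_ignore_initial_segment N_tendsto bounded_fun_const)
  ultimately have "\<bar>measure_pmf.expectation \<pi> (\<lambda>y. h y * rho_inf y) -
      measure_pmf.expectation \<pi> (\<lambda>y. h' y * rho_inf y)\<bar> \<le> K * (?p - ?p)"
    by (rule LIMSEQ_le) (use le in blast)
  then show ?thesis by (simp add: h'_def)
qed

text \<open>
  If \<open>lam (m + 1) * N d 1 - N (d + 1) psi\<close> were negative, the expected excess of queue
  \<open>m + 1\<close> over \<open>d + 1\<close> would tend to \<open>-\<infinity>\<close>.
\<close>

lemma limit_drift_nonneg:
  assumes d: "r \<le> d"
  shows "N (Suc d) psi \<le> lam (Suc m) * N d (\<lambda>_. 1)"
proof (rule ccontr)
  define D where "D = lam (Suc m) * N d (\<lambda>_. 1) + (- 1) * N (Suc d) psi"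
  assume "\<not> ?thesis"
  then have D: "D < 0" by (simp add: D_def)
  \<comment> \<open>Truncated subtraction makes \<open>W\<close> the positive part of the excess
    over \<open>d + 1\<close>.\<close>
  define W where "W = (\<lambda>x :: nat \<Rightarrow> nat. real (x (Suc m) - Suc d))"
  define q where "q = (\<lambda>x. lam (Suc m) * tail d x + (- 1) * (lift psi x * tail (Suc d) x))"
  define K where "K = lam (Suc m) / L"
  have K0: "0 \<le> K" using lam_pos[of "Suc m"] L_pos by (simp add: K_def)
  have q: "bounded_fun q"
    unfolding q_def by (intro bounded_fun_linear bounded_fun_mult bounded_lift bounded_psi bounded_tail)
  have JW: "J.T W = (\<lambda>x. 1 * W x + (1 / L) * q x)"
  proof
    fix x
    have "I.G W x = 0" by (auto simp: generator_def W_def)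
    moreover have "W (x(Suc m := x (Suc m) + 1)) - W x = tail d x"
      by (auto simp: W_def tail_def of_nat_diff)
    \<comment> \<open>A departure changes \<open>W\<close> only at lengths above
      \<open>d + 1\<close>, and there \<open>r \<le> d\<close> ensures that service is on.\<close>
    moreover have "rates (Suc m) x * (W (x(Suc m := x (Suc m) - 1)) - W x) = - (psi x * tail (Suc d) x)"
      using d by (auto simp: W_def tail_def rates_def of_nat_diff)
    ultimately show "J.T W x = 1 * W x + (1 / L) * q x"
      unfolding J_T_eq by (simp add: q_def lift_eq[OF psi_depends] diff_divide_distrib)
  qed
  have q_le: "(1 / L) * q x \<le> K" for x
    using psi_nonneg[of x] lam_pos[of "Suc m"] L_pos
    by (auto simp: q_def K_def tail_def lift_eq[OF psi_depends] divide_simps)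
  \<comment> \<open>\<open>W\<close> is unbounded, so its integrability comes from linear growth:
    each step adds at most \<open>K\<close> on average, and \<open>W\<close> starts at
    \<open>0\<close> because \<open>r \<le> d\<close>.\<close>
  have Wk: "0 \<le> (J.T ^^ k) W x" "(J.T ^^ k) W x \<le> W x + real k * K" for k x
  proof -
    have "(J.T ^^ k) (\<lambda>_. 0) x \<le> (J.T ^^ k) W x" by (rule J.Tk_mono) (simp add: W_def)
    then show "0 \<le> (J.T ^^ k) W x" by simp
    show "(J.T ^^ k) W x \<le> W x + real k * K"
    proof (induction k arbitrary: x)
      case (Suc k)
      have "(J.T ^^ Suc k) W x = (J.T ^^ k) (J.T W) x" by (simp add: funpow_swap1)
      also have "\<dots> \<le> (J.T ^^ k) (\<lambda>x. 1 * W x + 1 * K) x"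
        by (rule J.Tk_mono) (use q_le in \<open>simp add: JW\<close>)
      also have "\<dots> = (J.T ^^ k) W x + K" by (subst J.Tk_linear) simp
      also have "\<dots> \<le> W x + real (Suc k) * K" using Suc[of x] by (simp add: algebra_simps)
      finally show ?case .
    qed simp
  qed
  have W_start: "integrable (measure_pmf \<pi>) (\<lambda>y. (J.T ^^ k) W (y(Suc m := r)))" for k
  proof (rule integrable_pmf_bounded)
    show "\<bar>(J.T ^^ k) W (y(Suc m := r))\<bar> \<le> real k * K" for y
      using Wk[of k "y(Suc m := r)"] d by (simp add: W_def)
  qed
  have E_W: "E (Suc k) W = E k W + E k q / L" for k
    unfolding E_Suc JW unfolding E_def J.Tk_linear
    using W_start[of k] integrable_bounded_fun[OF bounded_start[OF q]] by simp
  have E_W_nonneg: "0 \<le> E k W" for k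
    unfolding E_def by (intro integral_nonneg_AE AE_I2 Wk)
  have "E k q = lam (Suc m) * E k (tail d) + (- 1) * E k (\<lambda>x. lift psi x * tail (Suc d) x)" for k
    unfolding q_def by (intro E_linear bounded_fun_mult bounded_lift bounded_psi bounded_tail)
  then have "(\<lambda>k. E k q) \<longlonglongrightarrow> D"
    unfolding D_def by (simp only:) (intro tendsto_intros E_tail_tendsto E_tendsto_N bounded_psi)
  then have "\<forall>\<^sub>F k in sequentially. E k q < D / 2"
    by (rule order_tendstoD) (use D in simp)
  then obtain k0 where k0: "\<And>k. k0 \<le> k \<Longrightarrow> E k q < D / 2"
    by (auto simp: eventually_sequentially)
  \<comment> \<open>From \<open>k0\<close> on, each step lowers the expectation by at least
    \<open>- D / 2 / L\<close>, which nonnegativity of \<open>W\<close> forbids in the long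
    run.\<close>
  have descent: "E (k0 + j) W \<le> E k0 W - real j * (- D / 2 / L)" for j
  proof (induction j)
    case (Suc j)
    have "E (k0 + j) q / L \<le> D / 2 / L"
      by (rule divide_right_mono) (use k0[of "k0 + j"] L_pos in auto)
    then show ?case using Suc E_W[of "k0 + j"] by (simp add: algebra_simps add_divide_distrib)
  qed simp
  have "0 < - D / 2 / L" using D L_pos by (intro divide_pos_pos) auto
  from reals_Archimedean3[OF this, rule_format, of "E k0 W"]
  obtain j where "E k0 W < real j * (- D / 2 / L)" by (rule exE)
  then show False using descent[of j] E_W_nonneg[of "k0 + j"] by linarith
qed

section \<open>Absence of escaping mass, and tightness\<close>

text \<open>If the escaping mass \<open>p\<close> were positive, its normalisation would be
  invariant and hence equal to \<open>\<pi>\<close>. The drift inequality would then become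
  \<open>p * \<pi>(psi) \<le> lam (Suc m) * p\<close> in the limit, against
  \<open>drift\<close>.\<close>

lemma no_escape: "measure_pmf.expectation \<pi> rho_inf = 0"
proof (rule ccontr)
  define p where "p = measure_pmf.expectation \<pi> rho_inf"
  have "0 \<le> p" unfolding p_def by (intro integral_nonneg_AE AE_I2 rho_inf_bounds)
  moreover assume "measure_pmf.expectation \<pi> rho_inf \<noteq> 0"
  ultimately have p: "0 < p" by (simp add: p_def)
  obtain p' where p': "set_pmf p' \<subseteq> set_pmf \<pi>"
    "\<And>f. measure_pmf.expectation p' f = measure_pmf.expectation \<pi> (\<lambda>x. f x * rho_inf x) / p"
    using weighted_pmf[OF rho_inf_bounds p[unfolded p_def]] unfolding p_def by blast
  have "p' = \<pi>"
  proof (rule pi_unique)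
    show "set_pmf p' \<subseteq> states m" using p'(1) pi_states by blast
    fix f :: "(nat \<Rightarrow> nat) \<Rightarrow> real" assume f: "bounded_fun f"
    \<comment> \<open>Invariance is available for \<open>lift f\<close>, which agrees with
      \<open>f\<close> at every state and at its neighbours.\<close>
    have "I.T f y = I.T (lift f) y" if "y \<in> states m" for y
      using that unfolding step_def generator_def
      by (auto simp: lift_states fun_upd_states simp del: fun_upd_apply intro!: sum.cong)
    then have "measure_pmf.expectation \<pi> (\<lambda>y. I.T f y * rho_inf y) =
        measure_pmf.expectation \<pi> (\<lambda>y. I.T (lift f) y * rho_inf y)"
      by (intro expectation_pi_cong) simp
    also have "\<dots> = measure_pmf.expectation \<pi> (\<lambda>y. f y * rho_inf y)"
      by (rule rho_inf_invariant[OF f])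
    finally show "measure_pmf.expectation p' (I.T f) = measure_pmf.expectation p' f"
      by (simp add: p'(2))
  qed
  then have psi: "measure_pmf.expectation \<pi> (\<lambda>y. psi y * rho_inf y) = p * measure_pmf.expectation \<pi> psi"
    using p'(2)[of psi] p by simp
  have "(\<lambda>d. N (Suc d) psi) \<longlonglongrightarrow> measure_pmf.expectation \<pi> (\<lambda>y. psi y * rho_inf y)"
    by (intro LIMSEQ_Suc N_tendsto bounded_psi)
  moreover have "(\<lambda>d. lam (Suc m) * N d (\<lambda>_. 1)) \<longlonglongrightarrow> lam (Suc m) * measure_pmf.expectation \<pi> (\<lambda>y. 1 * rho_inf y)"
    by (intro tendsto_intros N_tendsto bounded_fun_const)
  ultimately have "measure_pmf.expectation \<pi> (\<lambda>y. psi y * rho_inf y) \<le>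
      lam (Suc m) * measure_pmf.expectation \<pi> (\<lambda>y. 1 * rho_inf y)"
    by (rule LIMSEQ_le) (use limit_drift_nonneg in blast)
  then have "p * measure_pmf.expectation \<pi> psi \<le> lam (Suc m) * p"
    by (simp add: psi p_def)
  then show False using p drift by (simp add: mult.commute)
qed

lemma mono_coords_tail: "mono_coords {1..Suc m} (tail c)"
  unfolding mono_coords_def
proof (intro allI impI)
  fix x y :: "nat \<Rightarrow> nat" assume "\<forall>i\<in>{1..Suc m}. x i \<le> y i"
  then have "x (Suc m) \<le> y (Suc m)" by simp
  then show "tail c x \<le> tail c y" by (simp add: tail_def)
qed

text \<open>The tail probabilities increase with \<open>k\<close>, so their limit
  \<open>N c (\<lambda>_. 1)\<close> bounds them all at once, and it is small for large
  \<open>c\<close>.\<close>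

lemma tight:
  assumes "0 < e"
  shows "\<exists>c. \<forall>k. E k (tail c) \<le> e"
proof -
  have "(\<lambda>c. N c (\<lambda>_. 1)) \<longlonglongrightarrow> 0"
    using N_tendsto[OF bounded_fun_const[of 1]] no_escape by simp
  then have "\<forall>\<^sub>F c in sequentially. N c (\<lambda>_. 1) < e"
    by (rule order_tendstoD) (rule assms)
  then obtain c where c: "N c (\<lambda>_. 1) < e" by (auto simp: eventually_sequentially)
  have "E k (tail c) \<le> N c (\<lambda>_. 1)" for k
    by (intro incseq_le[OF _ E_tail_tendsto] incseq_SucI E_increasing mono_coords_tail bounded_tail)
  then show ?thesis using c by (meson less_imp_le order_trans)
qed

text \<open>Induction on the total content of \<open>x\<close>. Lowering one positive coordinate
  gives an up-set of positive mass; an arrival at that queue, of probability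
  \<open>lam j / L\<close> per step, leads from it into the up-set of \<open>x\<close>, and
  stationarity turns this into a lower bound on the mass.\<close>

lemma upset_pos: "0 < measure_pmf.expectation \<pi> (\<lambda>y. of_bool (\<forall>i\<in>{1..m}. x i \<le> y i) :: real)"
proof (induction "\<Sum>i\<in>{1..m}. x i" arbitrary: x)
  case 0
  then have "x i = 0" if "i \<in> {1..m}" for i using that by simp
  then show ?case by simp
next
  case (Suc s)
  define U where "U = (\<lambda>(x :: nat \<Rightarrow> nat) y. of_bool (\<forall>i\<in>{1..m}. x i \<le> y i) :: real)"
  obtain j where j: "j \<in> {1..m}" "0 < x j"
    using Suc(2) by (metis gr0I nat.distinct(1) sum.neutral)
  define x' where "x' = x(j := x j - 1)"
  have "(\<Sum>i\<in>{1..m}. x i) = x j + (\<Sum>i\<in>{1..m} - {j}. x i)"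
    "(\<Sum>i\<in>{1..m}. x' i) = x' j + (\<Sum>i\<in>{1..m} - {j}. x' i)"
    using j by (simp_all add: sum.remove)
  moreover have "(\<Sum>i\<in>{1..m} - {j}. x' i) = (\<Sum>i\<in>{1..m} - {j}. x i)"
    by (intro sum.cong) (auto simp: x'_def)
  ultimately have "s = (\<Sum>i\<in>{1..m}. x' i)" using Suc(2) j by (simp add: x'_def)
  from Suc(1)[OF this] have pos: "0 < measure_pmf.expectation \<pi> (U x')" by (simp add: U_def)
  have bd: "bounded_fun (U z)" for z by (auto simp: U_def intro!: bounded_funI[of _ 1])
  have "lam j / L * U x' y \<le> I.T (U x) y" for y
  proof -
    have "U x' y \<le> U x (y(j := y j + 1))" using j by (auto simp: U_def x'_def split: if_splits)
    then have "lam j / L * U x' y \<le> lam j / L * U x (y(j := y j + 1))"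
      using lam_pos[of j] L_pos j by (intro mult_left_mono) auto
    also have "\<dots> \<le> I.T (U x) y" by (rule I.T_ge_arrival) (use j in \<open>auto simp: U_def\<close>)
    finally show ?thesis .
  qed
  then have "measure_pmf.expectation \<pi> (\<lambda>y. lam j / L * U x' y) \<le> measure_pmf.expectation \<pi> (I.T (U x))"
    by (intro integral_mono integrable_bounded_fun I.bounded_fun_T bounded_fun_mult bounded_fun_const bd)
  also have "\<dots> = measure_pmf.expectation \<pi> (U x)" by (rule pi_stationary[OF bd])
  finally have "lam j / L * measure_pmf.expectation \<pi> (U x') \<le> measure_pmf.expectation \<pi> (U x)" by simp
  moreover have "0 < lam j / L * measure_pmf.expectation \<pi> (U x')"
    using pos lam_pos[of j] j L_pos by simp
  ultimately show ?case by (simp add: U_def)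
qed

text \<open>On the up-set of \<open>x\<close> an increasing function is at least its value at
  \<open>x\<close>. So the expectation from the stationary start is at least the value at
  \<open>x\<close> times the mass \<open>u\<close> of the up-set, and the level is chosen for
  \<open>e * u\<close>.\<close>

lemma tight_from:
  assumes x: "x (Suc m) \<le> r" and e: "0 < e"
  shows "\<exists>c. \<forall>k. (J.T ^^ k) (tail c) x \<le> e"
proof -
  define U where "U = (\<lambda>y. of_bool (\<forall>i\<in>{1..m}. x i \<le> y i) :: real)"
  have U: "bounded_fun U" by (auto simp: U_def intro!: bounded_funI[of _ 1])
  define u where "u = measure_pmf.expectation \<pi> U"
  have u: "0 < u" unfolding u_def U_def by (rule upset_pos)
  obtain c where c: "\<And>k. E k (tail c) \<le> e * u" using tight[of "e * u"] e u by auto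
  have mono: "mono_coords {1..Suc m} ((J.T ^^ k) (tail c))" for k
    by (intro J.Tk_mono_coords mono_coords_tail rates_antitone)
  have "(J.T ^^ k) (tail c) x * u \<le> e * u" for k
  proof -
    let ?F = "(J.T ^^ k) (tail c)"
    have "(J.T ^^ k) (\<lambda>_. 0) z \<le> ?F z" for z by (rule J.Tk_mono) (simp add: tail_def)
    then have nonneg: "0 \<le> ?F z" for z by simp
    have "?F x * U y \<le> ?F (y(Suc m := r))" for y
    proof (cases "\<forall>i\<in>{1..m}. x i \<le> y i")
      case True
      then have "?F x \<le> ?F (y(Suc m := r))"
        using x by (intro mono_coordsD[OF mono]) (auto simp: le_Suc_eq)
      then show ?thesis using True by (simp add: U_def)
    next
      case False
      then have "U y = 0" by (auto simp: U_def)
      then show ?thesis by (simp add: nonneg)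
    qed
    then have "measure_pmf.expectation \<pi> (\<lambda>y. ?F x * U y) \<le> E k (tail c)"
      unfolding E_def
      by (intro integral_mono integrable_bounded_fun bounded_start bounded_tail bounded_fun_mult bounded_fun_const U)
    then show ?thesis using c[of k] by (simp add: u_def)
  qed
  then show ?thesis using u by auto
qed

end

section \<open>Stationary distributions\<close>

context queue
begin

lemma expectation_Tk:
  assumes st: "\<And>f. bounded_fun f \<Longrightarrow> measure_pmf.expectation p (T f) = measure_pmf.expectation p f"
    and f: "bounded_fun f"
  shows "measure_pmf.expectation p ((T ^^ k) f) = measure_pmf.expectation p f"
  by (induction k) (use st bounded_fun_Tk[OF f] in auto)

text \<open>Each term of the Poisson mixture has the same expectation and the weights sum to
  \<open>1\<close>; boundedness of \<open>f\<close> permits exchanging sum and expectation.\<close>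

lemma expectation_semigroup:
  assumes st: "\<And>f. bounded_fun f \<Longrightarrow> measure_pmf.expectation p (T f) = measure_pmf.expectation p f"
    and f: "bounded_fun f" and t: "0 \<le> t"
  shows "measure_pmf.expectation p (semigroup f t) = measure_pmf.expectation p f"
proof -
  obtain C where C: "\<And>x. \<bar>f x\<bar> \<le> C" using f by (rule bounded_funE) blast
  let ?s = "L * t"
  have s: "0 \<le> ?s" using L_pos t by simp
  have le: "norm (?s ^ k / fact k * (T ^^ k) f x) \<le> ?s ^ k / fact k * C" for k x
    using mult_left_mono[OF Tk_bounded[of f C k x, OF C], of "?s ^ k / fact k"] s
    by (simp add: abs_mult)
  have sm: "summable (\<lambda>k. ?s ^ k / fact k * C)"
    by (intro summable_mult2 sums_summable[OF exp_sums])
  have int: "integrable (measure_pmf p) (\<lambda>x. ?s ^ k / fact k * (T ^^ k) f x)" for k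
    by (intro integrable_mult_right integrable_bounded_fun bounded_fun_Tk f)
  have "measure_pmf.expectation p (\<lambda>x. \<Sum>k. ?s ^ k / fact k * (T ^^ k) f x) =
      (\<Sum>k. measure_pmf.expectation p (\<lambda>x. ?s ^ k / fact k * (T ^^ k) f x))"
  proof (rule integral_suminf[OF int])
    show "AE x in measure_pmf p. summable (\<lambda>k. norm (?s ^ k / fact k * (T ^^ k) f x))"
      by (intro AE_I2 summable_comparison_test'[OF sm]) (use le in simp)
    have "measure_pmf.expectation p (\<lambda>x. norm (?s ^ k / fact k * (T ^^ k) f x)) \<le> ?s ^ k / fact k * C" for k
      by (rule measure_pmf.integral_le_const[OF integrable_norm[OF int]]) (use le in simp)
    then show "summable (\<lambda>k. measure_pmf.expectation p (\<lambda>x. norm (?s ^ k / fact k * (T ^^ k) f x)))"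
      by (intro summable_comparison_test'[OF sm]) (simp add: integral_nonneg_AE)
  qed
  also have "\<dots> = (\<Sum>k. ?s ^ k / fact k * measure_pmf.expectation p f)"
    by (simp only: integral_mult_right_zero expectation_Tk[OF st f])
  also have "\<dots> = exp ?s * measure_pmf.expectation p f"
    by (rule sums_unique[symmetric]) (intro sums_mult2 exp_sums)
  finally show ?thesis
    unfolding semigroup_def by (simp add: exp_minus)
qed

text \<open>Poisson weights sum to \<open>1\<close>, so a bound valid for all numbers of steps
  transfers to all times.\<close>

lemma semigroup_le:
  assumes le: "\<And>k. (T ^^ k) f x \<le> e" and f: "bounded_fun f" and t: "0 \<le> t"
  shows "semigroup f t x \<le> e"
proof -
  obtain C where C: "\<And>x. \<bar>f x\<bar> \<le> C" using f by (rule bounded_funE) blast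
  have s: "0 \<le> L * t" using L_pos t by simp
  have sm: "(\<lambda>k. (L * t) ^ k / fact k * e) sums (exp (L * t) * e)"
    by (intro sums_mult2 exp_sums)
  have "(\<Sum>k. (L * t) ^ k / fact k * (T ^^ k) f x) \<le> (\<Sum>k. (L * t) ^ k / fact k * e)"
    by (intro suminf_le mult_left_mono le summable_semigroup[of f C] C sums_summable[OF sm]) (use s in auto)
  also have "\<dots> = exp (L * t) * e" using sm by (simp add: sums_iff)
  finally have "exp (- (L * t)) * (\<Sum>k. (L * t) ^ k / fact k * (T ^^ k) f x) \<le> exp (- (L * t)) * (exp (L * t) * e)"
    by (intro mult_left_mono) auto
  also have "\<dots> = e" by (simp add: exp_minus)
  finally show ?thesis by (simp only: semigroup_def)
qed

text \<open>The mean value theorem supplies a constant majorant of the difference quotients, needed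
  to differentiate under the expectation at time \<open>0\<close>.\<close>

lemma semigroup_diff_le:
  assumes C: "\<And>x. \<bar>f x\<bar> \<le> C" and t: "0 < t"
  shows "\<bar>(semigroup f t x - f x) / t\<bar> \<le> 2 * L * C"
proof -
  have "\<exists>z. 0 < z \<and> z < t \<and> semigroup f t x - semigroup f 0 x = (t - 0) * G (semigroup f z) x"
    by (rule MVT2[OF t]) (rule semigroup_derivative[of f C, OF C])
  then obtain z where z: "0 < z" "semigroup f t x - f x = t * G (semigroup f z) x" by auto
  have b: "\<bar>semigroup f z y\<bar> \<le> C" for y
    by (rule semigroup_bounded[of f C, OF C]) (use z in simp)
  have "\<bar>T (semigroup f z) x\<bar> \<le> C"
    using Tk_bounded[of "semigroup f z" C "Suc 0" x, OF b] by simp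
  then have "\<bar>T (semigroup f z) x - semigroup f z x\<bar> \<le> 2 * C" using b[of x] by linarith
  from mult_left_mono[OF this, of L] have "\<bar>G (semigroup f z) x\<bar> \<le> 2 * L * C"
    unfolding G_eq abs_mult using L_pos by (simp add: mult_ac)
  then show ?thesis using z t by simp
qed

context
  fixes n :: nat
  assumes A: "A = {1..n}"
begin

text \<open>Stationarity makes the expectation of \<open>semigroup f t\<close> constant in
  \<open>t\<close>. Its derivative at time \<open>0\<close> is the expectation of
  \<open>G f\<close>, which therefore vanishes.\<close>

lemma stationary_expectation:
  assumes p: "stationary_distribution (states n) (queue_rates n lam g) p" and f: "bounded_fun f"
  shows "measure_pmf.expectation p (T f) = measure_pmf.expectation p f"
proof -
  obtain C where C: "\<And>x. \<bar>f x\<bar> \<le> C" using f by (rule bounded_funE) blast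
  obtain P where sub: "set_pmf p \<subseteq> states n" and P: "transition_function (states n) (queue_rates n lam g) P"
    and inv: "\<And>t. 0 \<le> t \<Longrightarrow> bind_pmf p (P t) = p"
    using p unfolding stationary_distribution_def by blast
  have zero: "measure_pmf.expectation p (\<lambda>x. (semigroup f t x - f x) / t) = 0" if t: "0 < t" for t
  proof -
    have "measure_pmf.expectation p f = measure_pmf.expectation p (\<lambda>x. measure_pmf.expectation (P t x) f)"
      using inv[of t] t expectation_bind_pmf[of f C p "P t", OF C] by simp
    also have "\<dots> = measure_pmf.expectation p (semigroup f t)"
    proof (rule integral_cong_AE)
      show "AE x in measure_pmf p. measure_pmf.expectation (P t x) f = semigroup f t x"
        unfolding AE_measure_pmf_iff
        by (intro ballI transition_function_unique[OF A P _ _ C]) (use sub t in auto)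
    qed auto
    finally have "measure_pmf.expectation p (semigroup f t) - measure_pmf.expectation p f = 0" by simp
    moreover have "integrable (measure_pmf p) (semigroup f t)"
      by (rule integrable_pmf_bounded[of _ _ C]) (use semigroup_bounded[of f C, OF C] t in simp)
    ultimately show ?thesis
      using integrable_bounded_fun[OF f, of p] by simp
  qed
  define \<tau> where "\<tau> = (\<lambda>k. 1 / real (Suc k))"
  have \<tau>: "0 < \<tau> k" for k by (simp add: \<tau>_def)
  have \<tau>_lim: "filterlim \<tau> (at 0) sequentially"
    unfolding filterlim_at using \<tau> LIMSEQ_inverse_real_of_nat
    by (auto simp: \<tau>_def inverse_eq_divide less_imp_neq[symmetric] del: of_nat_Suc)
  have "(\<lambda>k. measure_pmf.expectation p (\<lambda>x. (semigroup f (\<tau> k) x - f x) / \<tau> k)) \<longlonglongrightarrow> measure_pmf.expectation p (G f)"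
  proof (rule integral_dominated_convergence[where w="\<lambda>_. 2 * L * C"])
    show "AE x in measure_pmf p. (\<lambda>k. (semigroup f (\<tau> k) x - f x) / \<tau> k) \<longlonglongrightarrow> G f x"
    proof (rule AE_I2)
      fix x
      have "(\<lambda>h. (semigroup f (0 + h) x - semigroup f 0 x) / h) \<midarrow>0\<rightarrow> G (semigroup f 0) x"
        using semigroup_derivative[of f C x 0, OF C] unfolding DERIV_def .
      from filterlim_compose[OF this \<tau>_lim]
      show "(\<lambda>k. (semigroup f (\<tau> k) x - f x) / \<tau> k) \<longlonglongrightarrow> G f x"
        by (simp add: semigroup_0[abs_def])
    qed
    show "AE x in measure_pmf p. norm ((semigroup f (\<tau> k) x - f x) / \<tau> k) \<le> 2 * L * C" for k
      using semigroup_diff_le[of f C "\<tau> k", OF C \<tau>] by simp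
  qed auto
  then have "measure_pmf.expectation p (G f) = 0"
    unfolding zero[OF \<tau>] by (simp add: LIMSEQ_const_iff)
  moreover have "G f = (\<lambda>x. L * (T f x - f x))" by (simp add: G_eq fun_eq_iff)
  ultimately show ?thesis
    using L_pos integrable_bounded_fun[OF f, of p] integrable_bounded_fun[OF bounded_fun_T[OF f], of p] by simp
qed

text \<open>Invariance under \<open>T\<close> passes to the Poisson mixture, which on
  \<open>states n\<close> is the given transition function; indicators of points then identify the
  distribution.\<close>

lemma stationary_if_expectation:
  assumes ex: "\<exists>P. transition_function (states n) (queue_rates n lam g) P"
    and sub: "set_pmf p \<subseteq> states n"
    and st: "\<And>f. bounded_fun f \<Longrightarrow> measure_pmf.expectation p (T f) = measure_pmf.expectation p f"
  shows "stationary_distribution (states n) (queue_rates n lam g) p"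
proof -
  obtain P where P: "transition_function (states n) (queue_rates n lam g) P" using ex by blast
  have "bind_pmf p (P t) = p" if t: "0 \<le> t" for t
  proof (rule pmf_eqI)
    fix y
    let ?f = "indicator {y} :: (nat \<Rightarrow> nat) \<Rightarrow> real"
    have le: "\<bar>?f x\<bar> \<le> 1" for x by (simp add: indicator_abs_le_1)
    then have f: "bounded_fun ?f" by (rule bounded_funI)
    have "pmf (bind_pmf p (P t)) y = measure_pmf.expectation (bind_pmf p (P t)) ?f"
      by (simp add: pmf.rep_eq)
    also have "\<dots> = measure_pmf.expectation p (\<lambda>x. measure_pmf.expectation (P t x) ?f)"
      by (rule expectation_bind_pmf[OF le])
    also have "\<dots> = measure_pmf.expectation p (semigroup ?f t)"
    proof (rule integral_cong_AE)
      show "AE x in measure_pmf p. measure_pmf.expectation (P t x) ?f = semigroup ?f t x"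
        unfolding AE_measure_pmf_iff
        by (intro ballI transition_function_unique[OF A P _ _ le]) (use sub t in auto)
    qed auto
    also have "\<dots> = measure_pmf.expectation p ?f" by (rule expectation_semigroup[OF st f t])
    finally show "pmf (bind_pmf p (P t)) y = pmf p y" by (simp add: pmf.rep_eq)
  qed
  then show ?thesis using sub P unfolding stationary_distribution_def by blast
qed

end

end

text \<open>Connects the sum in \<open>mean_service\<close> with expectations.\<close>

lemma infsum_pmf_eq_expectation:
  assumes sub: "set_pmf p \<subseteq> S" and f: "bounded_fun f"
  shows "(\<Sum>\<^sub>\<infinity>x\<in>S. f x * pmf p x) = measure_pmf.expectation p f"
proof -
  obtain C where C: "\<And>x. \<bar>f x\<bar> \<le> C" using f by (rule bounded_funE) blast
  have C0: "0 \<le> C" using C abs_ge_zero order_trans by blast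
  have "integrable (count_space UNIV) (\<lambda>x. C * pmf p x)"
    by (intro integrable_mult_right pmf_abs_summable[unfolded abs_summable_on_def])
  then have "integrable (count_space UNIV) (\<lambda>x. pmf p x * f x)"
    by (rule Bochner_Integration.integrable_bound)
       (use C C0 in \<open>auto simp: abs_mult mult.commute intro!: mult_right_mono\<close>)
  then have "measure_pmf.expectation p f = (\<Sum>\<^sub>\<infinity>x\<in>UNIV. pmf p x * f x)"
    unfolding pmf_expectation_eq_infsetsum by (intro infsetsum_infsum) (simp add: abs_summable_on_def)
  also have "\<dots> = (\<Sum>\<^sub>\<infinity>x\<in>S. f x * pmf p x)"
    by (rule infsum_cong_neutral) (use sub in \<open>auto simp: set_pmf_iff mult.commute\<close>)
  finally show ?thesis ..
qed

section \<open>Lower partial limits\<close>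

definition tail_states :: "nat \<Rightarrow> nat \<Rightarrow> nat \<Rightarrow> (nat \<Rightarrow> nat) \<Rightarrow> (nat \<Rightarrow> nat) set" where
  "tail_states N m r x =
     {y\<in>states N. (\<forall>j\<in>{1..m}. y j = x j) \<and> (\<forall>j\<in>{m<..N}. y j > r)}"

text \<open>The expression under the limit in \<open>lower_partial_limit\<close>. For
  \<open>i = m + 1\<close> and fixed \<open>r\<close> it serves as the rate \<open>psi\<close> of
  the driven queue.\<close>

definition inf_rate ::
    "nat \<Rightarrow> (nat \<Rightarrow> (nat \<Rightarrow> nat) \<Rightarrow> real) \<Rightarrow> nat \<Rightarrow> nat \<Rightarrow> nat \<Rightarrow> (nat \<Rightarrow> nat) \<Rightarrow> real" where
  "inf_rate N \<phi> m i r x = (INF y\<in>tail_states N m r x. \<phi> i y)"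

locale allocation =
  fixes N :: nat and \<phi> :: "nat \<Rightarrow> (nat \<Rightarrow> nat) \<Rightarrow> real" and B :: real
  assumes phi_nonneg: "i \<in> {1..N} \<Longrightarrow> x \<in> states N \<Longrightarrow> 0 \<le> \<phi> i x"
    and phi_le: "i \<in> {1..N} \<Longrightarrow> x \<in> states N \<Longrightarrow> \<phi> i x \<le> B"
    and decreasing: "partially_decreasing N \<phi>"
begin

lemma phi_antimono:
  assumes "i \<in> {1..N}" "x \<in> states N" "y \<in> states N" "\<And>j. j \<in> {1..N} \<Longrightarrow> x j \<le> y j" "x i = y i"
  shows "\<phi> i y \<le> \<phi> i x"
  using decreasing assms unfolding partially_decreasing_def by blast

context
  fixes m i :: nat
  assumes m: "m \<le> N" and i: "i \<in> {1..N}"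
begin

text \<open>Guards the infimum in \<open>inf_rate\<close> against the empty set.\<close>

lemma tail_states_nonempty: "tail_states N m r x \<noteq> {}"
proof -
  have "(\<lambda>j\<in>{1..N}. if j \<le> m then x j else Suc r) \<in> tail_states N m r x"
    using m by (auto simp: tail_states_def states_def)
  then show ?thesis by blast
qed

lemma bdd_below_phi: "bdd_below (\<phi> i ` tail_states N m r x)"
  by (rule bdd_belowI2[of _ 0]) (use phi_nonneg i in \<open>auto simp: tail_states_def\<close>)

lemma inf_rate_lower: "y \<in> tail_states N m r x \<Longrightarrow> inf_rate N \<phi> m i r x \<le> \<phi> i y"
  unfolding inf_rate_def by (rule cINF_lower[OF bdd_below_phi])

lemma inf_rate_nonneg: "0 \<le> inf_rate N \<phi> m i r x"
  unfolding inf_rate_def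
  by (rule cINF_greatest[OF tail_states_nonempty]) (use phi_nonneg i in \<open>auto simp: tail_states_def\<close>)

lemma inf_rate_le: "inf_rate N \<phi> m i r x \<le> B"
proof -
  obtain y where y: "y \<in> tail_states N m r x" using tail_states_nonempty by blast
  have "\<phi> i y \<le> B" using y i phi_le by (auto simp: tail_states_def)
  then show ?thesis using inf_rate_lower[OF y] by linarith
qed

lemma inf_rate_mono: "r \<le> s \<Longrightarrow> inf_rate N \<phi> m i r x \<le> inf_rate N \<phi> m i s x"
  unfolding inf_rate_def
  by (rule cINF_superset_mono[OF tail_states_nonempty bdd_below_phi]) (auto simp: tail_states_def)

lemma inf_rate_tendsto:
  "(\<lambda>r. inf_rate N \<phi> m i r x) \<longlonglongrightarrow> lower_partial_limit N \<phi> m i x"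
proof -
  have "convergent (\<lambda>r. inf_rate N \<phi> m i r x)"
    by (intro Bseq_monoseq_convergent BseqI'[of _ B])
       (use inf_rate_nonneg inf_rate_le in \<open>auto simp: monoseq_def intro!: inf_rate_mono\<close>)
  then show ?thesis
    unfolding lower_partial_limit_def tail_states_def[symmetric] inf_rate_def[symmetric]
    by (simp add: convergent_LIMSEQ_iff)
qed

lemma lower_partial_limit_nonneg: "0 \<le> lower_partial_limit N \<phi> m i x"
  by (rule LIMSEQ_le_const[OF inf_rate_tendsto]) (use inf_rate_nonneg in blast)

lemma lower_partial_limit_le: "lower_partial_limit N \<phi> m i x \<le> B"
  by (rule LIMSEQ_le_const2[OF inf_rate_tendsto]) (use inf_rate_le in blast)

text \<open>Replacing the first \<open>m\<close> coordinates of a competitor for \<open>x\<close> by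
  those of \<open>y\<close> gives a competitor for \<open>y\<close> that lies above it and agrees
  with it in coordinate \<open>i\<close>, so its rate is no larger.\<close>

lemma inf_rate_antimono:
  assumes xy: "\<And>j. j \<in> {1..m} \<Longrightarrow> x j \<le> y j" and xyi: "i \<in> {1..m} \<Longrightarrow> x i = y i"
  shows "inf_rate N \<phi> m i r y \<le> inf_rate N \<phi> m i r x"
  unfolding inf_rate_def[of _ _ _ _ _ x]
proof (rule cINF_greatest[OF tail_states_nonempty])
  fix z assume z: "z \<in> tail_states N m r x"
  define z' where "z' = (\<lambda>j\<in>{1..N}. if j \<le> m then y j else z j)"
  have z': "z' \<in> tail_states N m r y"
    using z m by (auto simp: tail_states_def states_def z'_def)
  have "\<phi> i z' \<le> \<phi> i z"
  proof (rule phi_antimono[OF i])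
    show "z \<in> states N" "z' \<in> states N" using z z' by (auto simp: tail_states_def)
    show "z j \<le> z' j" if "j \<in> {1..N}" for j
      using z xy[of j] that by (auto simp: z'_def tail_states_def)
    show "z i = z' i"
      using z xyi i by (auto simp: z'_def tail_states_def)
  qed
  then show "inf_rate N \<phi> m i r y \<le> \<phi> i z" using inf_rate_lower[OF z'] by linarith
qed

lemma lower_partial_limit_antimono:
  assumes "\<And>j. j \<in> {1..m} \<Longrightarrow> x j \<le> y j" "i \<in> {1..m} \<Longrightarrow> x i = y i"
  shows "lower_partial_limit N \<phi> m i y \<le> lower_partial_limit N \<phi> m i x"
  by (rule LIMSEQ_le[OF inf_rate_tendsto inf_rate_tendsto])
     (use inf_rate_antimono[of x y] assms in blast)

text \<open>Raising the coordinates beyond \<open>m\<close> above \<open>r\<close> can only lower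
  the rate, provided that coordinate \<open>i\<close> is kept; the hypothesis lets it stay as it is
  while the raised state remains in \<open>tail_states\<close>.\<close>

lemma inf_rate_le_phi:
  assumes xi: "i \<le> m \<or> r < x i"
  shows "inf_rate N \<phi> m i r x \<le> \<phi> i (restrict x {1..N})"
proof -
  define z where "z = (\<lambda>j\<in>{1..N}. if j \<le> m \<or> j = i then x j else max (x j) (Suc r))"
  have z: "z \<in> tail_states N m r x"
    using xi m by (auto simp: tail_states_def states_def z_def)
  have "\<phi> i z \<le> \<phi> i (restrict x {1..N})"
    by (rule phi_antimono[OF i]) (use i in \<open>auto simp: z_def states_def\<close>)
  then show ?thesis using inf_rate_lower[OF z] by linarith
qed

lemma lower_partial_limit_le_phi:
  assumes "i \<le> m"
  shows "lower_partial_limit N \<phi> m i x \<le> \<phi> i (restrict x {1..N})"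
  by (rule LIMSEQ_le_const2[OF inf_rate_tendsto]) (use inf_rate_le_phi[of _ x] assms in blast)

end

end

section \<open>Markov processes\<close>

lemma countable_states: "countable (states n)"
  unfolding states_def by (intro countable_PiE) auto

text \<open>The finite-dimensional distributions at the two times \<open>0\<close> and
  \<open>t\<close> settle single states; countable additivity extends this to sets.\<close>

lemma markov_process_transition:
  assumes X: "markov_process M S q X" and S: "countable S"
  obtains P where "transition_function S q P"
    "\<And>x t A. x \<in> S \<Longrightarrow> 0 \<le> t \<Longrightarrow> A \<subseteq> S \<Longrightarrow>
      measure M {\<omega>\<in>space M. X 0 \<omega> = x \<and> X t \<omega> \<in> A} =
      measure M {\<omega>\<in>space M. X 0 \<omega> = x} * measure (measure_pmf (P t x)) A"
proof -
  interpret prob_space M using X by (simp add: markov_process_def)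
  have meas: "X t \<in> measurable M (count_space S)" if "0 \<le> t" for t
    using X that by (simp add: markov_process_def)
  obtain P where P: "transition_function S q P" and
    fdd: "\<And>(k::nat) (t::nat \<Rightarrow> real) x. 0 \<le> t 0 \<Longrightarrow> (\<forall>j<k. t j \<le> t (Suc j)) \<Longrightarrow> (\<forall>j\<le>k. x j \<in> S) \<Longrightarrow>
           measure M {\<omega>\<in>space M. \<forall>j\<le>k. X (t j) \<omega> = x j} =
             measure M {\<omega>\<in>space M. X (t 0) \<omega> = x 0} *
             (\<Prod>j<k. pmf (P (t (Suc j) - t j) (x j)) (x (Suc j)))"
    using X unfolding markov_process_def by blast
  have pair: "measure M {\<omega>\<in>space M. X 0 \<omega> = x \<and> X t \<omega> = y} =
      measure M {\<omega>\<in>space M. X 0 \<omega> = x} * pmf (P t x) y"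
    if "x \<in> S" "y \<in> S" "0 \<le> t" for x y t
  proof -
    define tt where "tt = (\<lambda>j::nat. if j = 0 then 0 else t)"
    define xx where "xx = (\<lambda>j::nat. if j = 0 then x else y)"
    have le1: "j \<le> Suc 0 \<longleftrightarrow> j = 0 \<or> j = Suc 0" for j :: nat by auto
    have "measure M {\<omega>\<in>space M. \<forall>j\<le>Suc 0. X (tt j) \<omega> = xx j} =
        measure M {\<omega>\<in>space M. X (tt 0) \<omega> = xx 0} *
        (\<Prod>j<Suc 0. pmf (P (tt (Suc j) - tt j) (xx j)) (xx (Suc j)))"
      by (rule fdd) (use that in \<open>auto simp: tt_def xx_def\<close>)
    moreover have "(\<forall>j\<le>Suc 0. X (tt j) \<omega> = xx j) \<longleftrightarrow> X 0 \<omega> = x \<and> X t \<omega> = y" for \<omega>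
      by (auto simp: le1 tt_def xx_def)
    ultimately show ?thesis by (simp add: tt_def xx_def)
  qed
  have "measure M {\<omega>\<in>space M. X 0 \<omega> = x \<and> X t \<omega> \<in> A} =
      measure M {\<omega>\<in>space M. X 0 \<omega> = x} * measure (measure_pmf (P t x)) A"
    if x: "x \<in> S" and t: "0 \<le> t" and A: "A \<subseteq> S" for x t A
  proof -
    define Z where "Z = (\<lambda>y. {\<omega>\<in>space M. X 0 \<omega> = x \<and> X t \<omega> = y})"
    have sets: "Z y \<in> sets M" if "y \<in> S" for y
    proof -
      have "X 0 -` {x} \<inter> space M \<in> sets M" "X t -` {y} \<inter> space M \<in> sets M"
        using measurable_sets[OF meas[of 0], of "{x}"] measurable_sets[OF meas[OF t], of "{y}"] x that by auto
      then have "(X 0 -` {x} \<inter> space M) \<inter> (X t -` {y} \<inter> space M) \<in> sets M" by (rule sets.Int)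
      also have "(X 0 -` {x} \<inter> space M) \<inter> (X t -` {y} \<inter> space M) = Z y" by (auto simp: Z_def)
      finally show ?thesis .
    qed
    have "{\<omega>\<in>space M. X 0 \<omega> = x \<and> X t \<omega> \<in> A} = (\<Union>y\<in>A. Z y)" by (auto simp: Z_def)
    then have "emeasure M {\<omega>\<in>space M. X 0 \<omega> = x \<and> X t \<omega> \<in> A} = (\<integral>\<^sup>+y. emeasure M (Z y) \<partial>count_space A)"
      using emeasure_UN_countable[of A Z M] sets A countable_subset[OF A S]
      by (auto simp: disjoint_family_on_def Z_def)
    also have "\<dots> = (\<integral>\<^sup>+y. ennreal (measure M {\<omega>\<in>space M. X 0 \<omega> = x}) * ennreal (pmf (P t x) y) \<partial>count_space A)"
      by (intro nn_integral_cong)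
         (use pair[OF x _ t] A in \<open>auto simp: emeasure_eq_measure Z_def ennreal_mult[symmetric]\<close>)
    also have "\<dots> = ennreal (measure M {\<omega>\<in>space M. X 0 \<omega> = x} * measure (measure_pmf (P t x)) A)"
      by (simp add: nn_integral_cmult nn_integral_pmf measure_pmf.emeasure_eq_measure ennreal_mult)
    finally show ?thesis
      by (simp add: emeasure_eq_measure)
  qed
  with P show ?thesis by (rule that)
qed

text \<open>For an arbitrary initial law, finitely many starting points carry all but
  \<open>e / 2\<close> of the mass, and the largest of their levels serves all of them.\<close>

lemma tight_if_tight_from_points:
  assumes X: "markov_process M S q X" and S: "countable S"
    and tight: "\<And>P x e. transition_function S q P \<Longrightarrow> x \<in> S \<Longrightarrow> 0 < e \<Longrightarrow>
      \<exists>c. \<forall>t\<ge>0. measure (measure_pmf (P t x)) {y\<in>S. c < h y} \<le> (e::real)"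
  shows "stable_process M UNIV (\<lambda>t \<omega>. h (X t \<omega>) :: nat)"
  unfolding stable_process_def
proof (intro allI impI)
  fix e :: real assume e: "0 < e"
  interpret prob_space M using X by (simp add: markov_process_def)
  have meas: "X t \<in> measurable M (count_space S)" if "0 \<le> t" for t
    using X that by (simp add: markov_process_def)
  obtain P where P: "transition_function S q P"
    "\<And>x t A. x \<in> S \<Longrightarrow> 0 \<le> t \<Longrightarrow> A \<subseteq> S \<Longrightarrow>
      measure M {\<omega>\<in>space M. X 0 \<omega> = x \<and> X t \<omega> \<in> A} =
      measure M {\<omega>\<in>space M. X 0 \<omega> = x} * measure (measure_pmf (P t x)) A"
    using markov_process_transition[OF X S] by blast
  have X_in: "X t \<omega> \<in> S" if "0 \<le> t" "\<omega> \<in> space M" for t \<omega>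
    using measurable_space[OF meas[OF that(1)] that(2)] by simp
  have sets_X: "{\<omega>\<in>space M. X t \<omega> \<in> A} \<in> sets M" if "0 \<le> t" for t A
  proof -
    have "X t -` (A \<inter> S) \<inter> space M \<in> sets M" by (rule measurable_sets[OF meas[OF that]]) auto
    also have "X t -` (A \<inter> S) \<inter> space M = {\<omega>\<in>space M. X t \<omega> \<in> A}" using X_in that by auto
    finally show ?thesis .
  qed
  define Y where "Y = from_nat_into S"
  define F where "F = (\<lambda>n. Y ` {..<n::nat})"
  have fin: "finite (F n)" for n by (simp add: F_def)
  \<comment> \<open>The event that the process starts outside the first \<open>n\<close> enumerated
    states; it decreases to the empty set.\<close>
  define D where "D = (\<lambda>n. {\<omega>\<in>space M. X 0 \<omega> \<in> - F n})"
  have "(\<lambda>n. measure M (D n)) \<longlonglongrightarrow> measure M (\<Inter>n. D n)"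
    by (rule finite_Lim_measure_decseq)
       (auto simp: D_def F_def decseq_def intro: sets_X[of 0 "- (Y ` {..<_})", simplified])
  also have "(\<Inter>n. D n) = {}"
  proof -
    have "\<exists>n. \<omega> \<notin> D n" for \<omega>
    proof (cases "\<omega> \<in> space M")
      case True
      then obtain n where "X 0 \<omega> = Y n"
        unfolding Y_def using X_in[of 0 \<omega>] S by (metis from_nat_into_surj order_refl)
      then have "\<omega> \<notin> D (Suc n)" by (auto simp: D_def F_def)
      then show ?thesis by blast
    qed (simp add: D_def)
    then show ?thesis by blast
  qed
  finally have "\<forall>\<^sub>F n in sequentially. measure M (D n) < e / 2"
    by (intro order_tendstoD) (use e in auto)
  then obtain n where n: "measure M (D n) < e / 2" by (auto simp: eventually_sequentially)
  have "\<forall>x\<in>F n \<inter> S. \<exists>c. \<forall>t\<ge>0. measure (measure_pmf (P t x)) {y\<in>S. c < h y} \<le> e / 2"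
    using tight[OF P(1) _ half_gt_zero[OF e]] by blast
  then obtain c where c: "\<And>x t. x \<in> F n \<inter> S \<Longrightarrow> 0 \<le> t \<Longrightarrow> measure (measure_pmf (P t x)) {y\<in>S. c x < h y} \<le> e / 2"
    by metis
  define c' where "c' = Max (insert 0 (c ` (F n \<inter> S)))"
  have c': "c x \<le> c'" if "x \<in> F n \<inter> S" for x
    unfolding c'_def using that fin by (intro Max_ge) auto
  have "measure M {\<omega>\<in>space M. h (X t \<omega>) \<notin> {..c'}} \<le> e" if t: "0 \<le> t" for t
  proof -
    define A where "A = {y\<in>S. c' < h y}"
    define Z where "Z = (\<lambda>x. {\<omega>\<in>space M. X 0 \<omega> = x \<and> X t \<omega> \<in> A})"
    have Z_sets: "Z x \<in> sets M" for x
    proof -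
      have "{\<omega>\<in>space M. X 0 \<omega> \<in> {x}} \<inter> {\<omega>\<in>space M. X t \<omega> \<in> A} \<in> sets M"
        by (intro sets.Int sets_X t) simp
      also have "{\<omega>\<in>space M. X 0 \<omega> \<in> {x}} \<inter> {\<omega>\<in>space M. X t \<omega> \<in> A} = Z x" by (auto simp: Z_def)
      finally show ?thesis .
    qed
    have D_sets: "D n \<in> sets M" unfolding D_def by (rule sets_X) simp
    have "{\<omega>\<in>space M. h (X t \<omega>) \<notin> {..c'}} \<subseteq> D n \<union> (\<Union>x\<in>F n \<inter> S. Z x)"
      using X_in t by (auto simp: D_def Z_def A_def)
    then have "measure M {\<omega>\<in>space M. h (X t \<omega>) \<notin> {..c'}} \<le> measure M (D n \<union> (\<Union>x\<in>F n \<inter> S. Z x))"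
      by (rule finite_measure_mono) (use D_sets Z_sets fin in \<open>auto intro!: sets.finite_UN\<close>)
    also have "\<dots> \<le> measure M (D n) + measure M (\<Union>x\<in>F n \<inter> S. Z x)"
      by (rule measure_Un_le) (use D_sets Z_sets fin in \<open>auto intro!: sets.finite_UN\<close>)
    also have "measure M (\<Union>x\<in>F n \<inter> S. Z x) \<le> (\<Sum>x\<in>F n \<inter> S. measure M (Z x))"
      by (rule measure_UNION_le) (use Z_sets fin in auto)
    also have "\<dots> \<le> (\<Sum>x\<in>F n \<inter> S. measure M {\<omega>\<in>space M. X 0 \<omega> = x} * (e / 2))"
    proof (rule sum_mono)
      fix x assume x: "x \<in> F n \<inter> S"
      have "measure M (Z x) = measure M {\<omega>\<in>space M. X 0 \<omega> = x} * measure (measure_pmf (P t x)) A"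
        unfolding Z_def by (rule P(2)) (use x t in \<open>auto simp: A_def\<close>)
      also have "measure (measure_pmf (P t x)) A \<le> measure (measure_pmf (P t x)) {y\<in>S. c x < h y}"
        by (rule measure_pmf.finite_measure_mono) (use c'[OF x] in \<open>auto simp: A_def\<close>)
      also have "\<dots> \<le> e / 2" by (rule c[OF x t])
      finally show "measure M (Z x) \<le> measure M {\<omega>\<in>space M. X 0 \<omega> = x} * (e / 2)"
        by (simp add: mult_left_mono)
    qed
    \<comment> \<open>The events of different initial states are disjoint, so their probabilities
      add up to at most \<open>1\<close>.\<close>
    also have "\<dots> = measure M (\<Union>x\<in>F n \<inter> S. {\<omega>\<in>space M. X 0 \<omega> = x}) * (e / 2)"
      unfolding sum_distrib_right[symmetric]
      by (subst finite_measure_finite_Union)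
         (use fin sets_X[of 0 "{_}", simplified] in \<open>auto simp: disjoint_family_on_def\<close>)
    also have "\<dots> \<le> 1 * (e / 2)"
      by (rule mult_right_mono[OF prob_le_1]) (use e in simp)
    finally show ?thesis using n by simp
  qed
  then show "\<exists>K\<subseteq>UNIV. finite K \<and> (\<forall>t\<ge>0. measure M {\<omega>\<in>space M. h (X t \<omega>) \<notin> K} \<le> e)"
    by (intro exI[of _ "{..c'}"]) auto
qed

lemma transition_function_cong:
  assumes P: "transition_function S q P" and q: "\<And>x y. x \<in> S \<Longrightarrow> q x y = q' x y"
  shows "transition_function S q' P"
proof -
  have "(\<Sum>\<^sub>\<infinity>y\<in>S - {x}. q x y) = (\<Sum>\<^sub>\<infinity>y\<in>S - {x}. q' x y)" if "x \<in> S" for x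
    by (rule infsum_cong) (rule q[OF that])
  with P q show ?thesis unfolding transition_function_def by simp
qed

text \<open>
  For \<open>m = 0\<close> the environment has a single state; otherwise its stationary distribution exists,
  since a mean service rate that exceeds the positive arrival rate is not the default value \<open>0\<close>.
\<close>

lemma environment_distribution:
  fixes lam :: "nat \<Rightarrow> real"
  assumes al: "allocation N \<phi> B" and m: "Suc m \<le> N"
    and Q: "queue {1..m} lam (lower_partial_limit N \<phi> m) L B"
    and pos: "0 < lam (Suc m)" and less: "lam (Suc m) < mean_service N \<phi> m (Suc m) lam"
  obtains p where "set_pmf p \<subseteq> states m"
    "\<And>f. bounded_fun f \<Longrightarrow> measure_pmf.expectation p (step {1..m} lam (lower_partial_limit N \<phi> m) L f) =
        measure_pmf.expectation p f"
    "\<And>p'. set_pmf p' \<subseteq> states m \<Longrightarrow>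
        (\<And>f. bounded_fun f \<Longrightarrow> measure_pmf.expectation p' (step {1..m} lam (lower_partial_limit N \<phi> m) L f) =
          measure_pmf.expectation p' f) \<Longrightarrow> p' = p"
    "lam (Suc m) < measure_pmf.expectation p (lower_partial_limit N \<phi> m (Suc m))"
proof -
  interpret allocation N \<phi> B by (rule al)
  interpret Q: queue "{1..m}" lam "lower_partial_limit N \<phi> m" L B by (rule Q)
  show thesis
  proof (cases "m = 0")
    case True
    let ?u = "(\<lambda>_. undefined) :: nat \<Rightarrow> nat"
    have states: "states m = {?u}" using True by (simp add: states_def)
    show ?thesis
    proof (rule that[of "return_pmf ?u"])
      show "measure_pmf.expectation (return_pmf ?u) (step {1..m} lam (lower_partial_limit N \<phi> m) L f) =
        measure_pmf.expectation (return_pmf ?u) f" for f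
        using True by (simp add: step_def generator_def)
      show "p' = return_pmf ?u" if "set_pmf p' \<subseteq> states m" for p'
        using that unfolding states by (simp add: set_pmf_subset_singleton)
      show "lam (Suc m) < measure_pmf.expectation (return_pmf ?u) (lower_partial_limit N \<phi> m (Suc m))"
        using less True by (simp add: mean_service_def)
    qed (simp add: states)
  next
    case False
    let ?st = "stationary_distribution (states m) (limiting_rates N \<phi> m lam)"
    have ex1: "\<exists>!p. ?st p"
      using less pos False unfolding mean_service_def by (auto split: if_splits)
    define p where "p = (THE p. ?st p)"
    have p: "?st p" unfolding p_def by (rule theI'[OF ex1])
    then have p_states: "set_pmf p \<subseteq> states m" by (simp add: stationary_distribution_def)
    show ?thesis
    proof (rule that[of p])
      show "measure_pmf.expectation p (Q.T f) = measure_pmf.expectation p f" if "bounded_fun f" for f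
        by (rule Q.stationary_expectation[OF refl p[unfolded limiting_rates_def] that])
      show "p' = p" if "set_pmf p' \<subseteq> states m"
        "\<And>f. bounded_fun f \<Longrightarrow> measure_pmf.expectation p' (Q.T f) = measure_pmf.expectation p' f" for p'
      proof -
        \<comment> \<open>The transition function demanded by
          \<open>stationary_if_expectation\<close> is one that witnesses stationarity of
          \<open>p\<close>.\<close>
        have "?st p'"
          unfolding limiting_rates_def
          by (rule Q.stationary_if_expectation[OF refl _ that])
             (use p in \<open>auto simp: stationary_distribution_def limiting_rates_def\<close>)
        then show ?thesis using ex1 p by blast
      qed
      have "\<bar>lower_partial_limit N \<phi> m (Suc m) x\<bar> \<le> B" for x
        using lower_partial_limit_nonneg[of m "Suc m" x] lower_partial_limit_le[of m "Suc m" x] m by simp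
      then have bd: "bounded_fun (lower_partial_limit N \<phi> m (Suc m))" by (rule bounded_funI)
      have "mean_service N \<phi> m (Suc m) lam =
          (\<Sum>\<^sub>\<infinity>x\<in>states m. lower_partial_limit N \<phi> m (Suc m) x * pmf p x)"
        unfolding mean_service_def p_def using False ex1 by simp
      also have "\<dots> = measure_pmf.expectation p (lower_partial_limit N \<phi> m (Suc m))"
        by (rule infsum_pmf_eq_expectation[OF p_states bd])
      finally show "lam (Suc m) < measure_pmf.expectation p (lower_partial_limit N \<phi> m (Suc m))"
        using less by simp
    qed (rule p_states)
  qed
qed

section \<open>Comparison of the network with the driven queue\<close>

theorem theorem2:
  fixes N n :: nat
    and lam :: "nat \<Rightarrow> real"
    and \<phi> :: "nat \<Rightarrow> (nat \<Rightarrow> nat) \<Rightarrow> real"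
    and M :: "'w measure"
    and X :: "real \<Rightarrow> 'w \<Rightarrow> (nat \<Rightarrow> nat)"
  assumes lam_pos: "\<forall>i\<in>{1..N}. lam i > 0"
    and phi_nonneg: "\<forall>i\<in>{1..N}. \<forall>x\<in>states N. \<phi> i x \<ge> 0"
    and phi_bounded: "\<exists>B. \<forall>i\<in>{1..N}. \<forall>x\<in>states N. \<phi> i x \<le> B"
    and phi_decreasing: "partially_decreasing N \<phi>"
    and X_queue: "markov_process M (states N) (queue_rates N lam \<phi>) X"
    and n: "n \<in> {1..N}"
    and stability_condition: "\<forall>i\<in>{1..n}. lam i < mean_service N \<phi> (i - 1) i lam"
  shows "\<forall>i\<in>{1..n}. stable_process M UNIV (\<lambda>t \<omega>. X t \<omega> i)"
proof
  fix i assume i: "i \<in> {1..n}"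
  define m where "m = i - 1"
  have im: "i = Suc m" "Suc m \<le> N" using i n by (auto simp: m_def)
  have less: "lam (Suc m) < mean_service N \<phi> m (Suc m) lam"
    using stability_condition i by (auto simp: m_def im(1)[symmetric])
  obtain B0 where B0: "\<forall>i\<in>{1..N}. \<forall>x\<in>states N. \<phi> i x \<le> B0" using phi_bounded by blast
  define B where "B = max B0 0"
  have B_nonneg: "0 \<le> B" by (simp add: B_def)
  interpret allocation N \<phi> B
    by standard (use phi_nonneg B0 phi_decreasing in \<open>auto simp: B_def le_max_iff_disj\<close>)
  define ell where "ell = lower_partial_limit N \<phi> m"
  \<comment> \<open>The locale \<open>queue\<close> bounds the rates at every function; precomposing
    with restriction extends \<open>\<phi>\<close> from \<open>states N\<close> without changing it
    there.\<close>
  define \<phi>' where "\<phi>' = (\<lambda>i x. \<phi> i (restrict x {1..N}))"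
  \<comment> \<open>One uniformisation rate serves the full network, the environment and the driven
    queue, so that their one-step operators are comparable.\<close>
  define L where "L = (\<Sum>i\<in>{1..N}. lam i + B)"
  have L_pos: "0 < L"
    unfolding L_def by (rule sum_pos) (use lam_pos n B_nonneg in \<open>auto intro: add_pos_nonneg\<close>)
  have L_ge: "(\<Sum>i\<in>{1..k}. lam i + B) \<le> L" if "k \<le> N" for k
  proof -
    have "0 \<le> lam j + B" if "j \<in> {1..N}" for j
      using lam_pos B_nonneg that by (simp add: add_nonneg_nonneg less_imp_le)
    then show ?thesis unfolding L_def by (intro sum_mono2) (use that in auto)
  qed
  have restrict_states: "restrict x {1..N} \<in> states N" for x :: "nat \<Rightarrow> nat"
    by (simp add: states_def)
  interpret Q: queue "{1..N}" lam \<phi>' L B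
    by standard
       (use lam_pos L_pos L_ge[of N] restrict_states phi_nonneg phi_le in \<open>auto simp: \<phi>'_def less_imp_le\<close>)
  have ell: "0 \<le> ell j x" "ell j x \<le> B" if "j \<in> {1..N}" for j x
    using lower_partial_limit_nonneg[of m j x] lower_partial_limit_le[of m j x] im that by (auto simp: ell_def)
  have env: "queue {1..m} lam (lower_partial_limit N \<phi> m) L B"
    unfolding ell_def[symmetric]
    by standard (use lam_pos L_pos L_ge[of m] ell im in \<open>auto simp: less_imp_le\<close>)
  have "0 < lam (Suc m)" using lam_pos im by simp
  from environment_distribution[OF allocation_axioms im(2) env this less]
  obtain p where p: "set_pmf p \<subseteq> states m"
    "\<And>f. bounded_fun f \<Longrightarrow> measure_pmf.expectation p (step {1..m} lam ell L f) = measure_pmf.expectation p f"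
    "\<And>p'. set_pmf p' \<subseteq> states m \<Longrightarrow>
        (\<And>f. bounded_fun f \<Longrightarrow> measure_pmf.expectation p' (step {1..m} lam ell L f) =
          measure_pmf.expectation p' f) \<Longrightarrow> p' = p"
    "lam (Suc m) < measure_pmf.expectation p (ell (Suc m))"
    unfolding ell_def[symmetric] by blast
  have rate: "0 \<le> inf_rate N \<phi> m (Suc m) r x" "inf_rate N \<phi> m (Suc m) r x \<le> B" for r x
    using inf_rate_nonneg[of m "Suc m" r x] inf_rate_le[of m "Suc m" r x] im by auto
  \<comment> \<open>The infima converge boundedly to the lower partial limit, so the strict drift
    condition already holds at every large finite \<open>r\<close>.\<close>
  have "(\<lambda>r. measure_pmf.expectation p (inf_rate N \<phi> m (Suc m) r)) \<longlonglongrightarrow> measure_pmf.expectation p (ell (Suc m))"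
    by (rule integral_dominated_convergence[where w="\<lambda>_. B"])
       (use rate inf_rate_tendsto[of m "Suc m"] im in \<open>auto simp: ell_def\<close>)
  then have "\<forall>\<^sub>F r in sequentially. lam (Suc m) < measure_pmf.expectation p (inf_rate N \<phi> m (Suc m) r)"
    by (rule order_tendstoD) (rule p(4))
  then obtain r0 where r0: "\<And>r. r0 \<le> r \<Longrightarrow> lam (Suc m) < measure_pmf.expectation p (inf_rate N \<phi> m (Suc m) r)"
    by (auto simp: eventually_sequentially)
  have antitone: "antitone_rates {1..m} ell"
    unfolding antitone_rates_def ell_def
    by (intro ballI allI impI lower_partial_limit_antimono) (use im in auto)
  show "stable_process M UNIV (\<lambda>t \<omega>. X t \<omega> i)"
    unfolding im(1)
  proof (rule tight_if_tight_from_points[OF X_queue countable_states, where h="\<lambda>x. x (Suc m)"])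
    fix P x and e :: real
    assume P: "transition_function (states N) (queue_rates N lam \<phi>) P" and x: "x \<in> states N" and e: "0 < e"
    have P': "transition_function (states N) (queue_rates N lam \<phi>') P"
    proof (rule transition_function_cong[OF P])
      show "queue_rates N lam \<phi> x y = queue_rates N lam \<phi>' x y" if "x \<in> states N" for x y
      proof -
        have "restrict x {1..N} = x" using that unfolding states_def by (rule PiE_restrict)
        then show ?thesis unfolding queue_rates_def \<phi>'_def by (simp only:)
      qed
    qed
    \<comment> \<open>Besides being large, \<open>r\<close> must be at least the initial length of
      queue \<open>m + 1\<close>, as \<open>tight_from\<close> requires.\<close>
    define r where "r = max r0 (x (Suc m))"
    interpret D: driven_queue m lam ell "inf_rate N \<phi> m (Suc m) r" p L B r
    proof
      show "inf_rate N \<phi> m (Suc m) r z \<le> inf_rate N \<phi> m (Suc m) r y"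
        if "\<And>j. j \<in> {1..m} \<Longrightarrow> y j \<le> z j" for y z
        by (rule inf_rate_antimono) (use im that in auto)
      show "p' = p" if "set_pmf p' \<subseteq> states m"
        "\<And>f. bounded_fun f \<Longrightarrow> measure_pmf.expectation p' (step {1..m} lam ell L f) =
          measure_pmf.expectation p' f" for p'
        by (rule p(3)[OF that])
    qed (use lam_pos im ell antitone rate L_pos L_ge[of "Suc m"] p(1,2) r0[of r] in \<open>auto simp: r_def\<close>)
    obtain c where c: "\<And>k. (D.J.T ^^ k) (D.tail c) x \<le> e"
      using D.tight_from[of x e] e by (auto simp: r_def)
    \<comment> \<open>For queue \<open>m + 1\<close> the infimum is used above \<open>r\<close> and
      the rate \<open>0\<close> at or below it; for the environment the lower partial limit lies
      below the true rate.\<close>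
    have rates_le: "D.rates j y \<le> \<phi>' j y" if "j \<in> {1..Suc m}" for j y
    proof (cases "j = Suc m")
      case True
      then show ?thesis
        using inf_rate_le_phi[of m j r y] Q.g_nonneg[of j y] that im by (auto simp: D.rates_def \<phi>'_def)
    next
      case False
      have "ell j y \<le> \<phi>' j y"
        using lower_partial_limit_le_phi[of m j y] that False im by (auto simp: \<phi>'_def ell_def)
      then show ?thesis using False by (simp add: D.rates_def)
    qed
    have Q_le: "(Q.T ^^ k) (D.tail c) x \<le> e" for k
    proof -
      have "(Q.T ^^ k) (D.tail c) x \<le> (D.J.T ^^ k) (D.tail c) x"
        by (rule D.J.Tk_dominated[OF D.mono_coords_tail _ rates_le Q.queue_axioms D.rates_antitone])
           (use im in auto)
      then show ?thesis using c[of k] by linarith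
    qed
    have "measure (measure_pmf (P t x)) {y\<in>states N. c < y (Suc m)} \<le> e" if t: "0 \<le> t" for t
    proof -
      have tail1: "\<bar>D.tail c y\<bar> \<le> 1" for y by (simp add: D.tail_def)
      have "measure (measure_pmf (P t x)) {y\<in>states N. c < y (Suc m)} =
          measure_pmf.expectation (P t x) (indicator {y\<in>states N. c < y (Suc m)})"
        by simp
      also have "\<dots> \<le> measure_pmf.expectation (P t x) (D.tail c)"
        by (intro integral_mono integrable_pmf_bounded[of _ _ 1])
           (auto simp: D.tail_def indicator_def)
      also have "\<dots> = Q.semigroup (D.tail c) t x"
        by (rule Q.transition_function_unique[OF refl P' x t tail1])
      also have "\<dots> \<le> e"
        by (rule Q.semigroup_le[OF Q_le D.bounded_tail t])
      finally show ?thesis .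
    qed
    then show "\<exists>c. \<forall>t\<ge>0. measure (measure_pmf (P t x)) {y\<in>states N. c < y (Suc m)} \<le> e" by blast
  qed
qed

end
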